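(* Let $m\ge1$, $n\ge0$, and let $\bm\lambda=(\lambda^{(1)},\dots,\lambda^{(m)})$ be an $m$-multipartition of $n$, with componentwise conjugate $\bm\lambda^t=((\lambda^{(1)})^t,\dots,(\lambda^{(m)})^t)$. Then $$\mathscr G_{\bm\lambda}(Z;\mathfrak q^{-1},\bm u)=(-\mathfrak q)^{-n}\,\mathscr G_{\bm\lambda^t}(Z;\mathfrak q,\bm u).$$ Equivalently, for every $\bm\alpha\in\mathscr A_m$ with $|\bm\alpha|=n$, $$\chi^{\bm\lambda}_{\bm\alpha}(\mathfrak q,\bm u)=(-\mathfrak q)^{n-\ell(\bm\alpha)}\,\chi^{\bm\lambda^t}_{\bm\alpha}(\mathfrak q^{-1},\bm u).$$ In particular, for every $m$-multipartition $\bm\mu$ of $n$, $\chi^{\bm\lambda}_{\bm\mu}(\mathfrak q,\bm u)=(-\mathfrak q)^{n-\ell(\bm\mu)}\,\chi^{\bm\lambda^t}_{\bm\mu}(\mathfrak q^{-1},\bm u)$.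
   Context: The base field is $\mathbb C(\mathfrak q,u_1,\dots,u_m)$. $\mathscr A_m$ is the set of arrays $\bm\alpha=(\alpha_{i,j})_{1\le i\le m,\,j\ge1}$ of nonnegative integers with finite support; $Z^{\bm\alpha}=\prod z_{i,j}^{\alpha_{i,j}}$, $|\bm\alpha|=\sum\alpha_{i,j}$, $\ell(\bm\alpha)=\#\{(i,j):\alpha_{i,j}>0\}$. A multipartition $\bm\mu$ is viewed in $\mathscr A_m$ via $\alpha_{i,j}=\mu^{(i)}_j$; then $\ell(\bm\mu)=\sum_i\ell(\mu^{(i)})$. Let $\sum_rq_r(X;t)z^r=\prod_i\frac{1-tx_iz}{1-x_iz}$. With independent alphabets $X^{(1)},\dots,X^{(m)}$ put $s_{\bm\lambda}(X)=\prod_rs_{\lambda^{(r)}}(X^{(r)})$ and, for $1\le i\le m$, $a\ge1$, $$q^{(i)}_a(X;\mathfrak q,\bm u)=\frac{\mathfrak q^a}{\mathfrak q-1}\sum_{c\in\mathbb Z_{\ge0}^m,\ \sum c_r=a}u_{\kappa(c)}^{\,i-1}\prod_{r=1}^mq_{c_r}(X^{(r)};\mathfrak q^{-1}),\qquad\kappa(c)=\max\{r:c_r\ne0\}.$$ The coefficients $\chi^{\bm\lambda}_{\bm\alpha}=\chi^{\bm\lambda}_{\bm\alpha}(\mathfrak q,\bm u)$ are defined by $\prod_{(i,j):\alpha_{i,j}>0}q^{(i)}_{\alpha_{i,j}}(X;\mathfrak q,\bm u)=\sum_{\bm\lambda}\chi^{\bm\lambda}_{\bm\alpha}s_{\bm\lambda}(X)$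 (sum over all $m$-multipartitions). By Shoji's Frobenius formula, for a multipartition $\bm\mu$ of $n$, $\chi^{\bm\lambda}_{\bm\mu}$ is the value of the irreducible character of the Ariki--Koike algebra of type $G(m,1,n)$ labelled $\bm\lambda$ on the standard element labelled $\bm\mu$. The generating function is $$\mathscr G_{\bm\lambda}(Z;\mathfrak q,\bm u)=\sum_{\bm\alpha\in\mathscr A_m}(\mathfrak q-1)^{\ell(\bm\alpha)}\chi^{\bm\lambda}_{\bm\alpha}(\mathfrak q,\bm u)\,Z^{\bm\alpha};$$ replacing $\mathfrak q$ by $\mathfrak q^{-1}$ is applied to all coefficients, with $\bm u$ and $Z$ fixed. *)

theory Defs
  imports
    Complex_Main
    "HOL-Library.Poly_Mapping"
    "HOL-Computational_Algebra.Polynomial"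
    "HOL-Computational_Algebra.Formal_Power_Series"
    "HOL-Computational_Algebra.Fraction_Field"
begin

section \<open>Formal power series in an arbitrary set of variables\<close>

text \<open>Series in variables of type \<open>'v\<close>, possibly infinitely many; a monomial is a finitely
  supported exponent function \<open>'v \<Rightarrow>\<^sub>0 nat\<close>.\<close>

typedef ('v, 'a) mfps = "UNIV :: (('v \<Rightarrow>\<^sub>0 nat) \<Rightarrow> 'a) set"
  morphisms mcoeff Abs_mfps
  by simp

lemma mcoeff_Abs_mfps [simp]: "mcoeff (Abs_mfps f) = f"
  by (simp add: Abs_mfps_inverse)

lemma mfps_eqI: "(\<And>e. mcoeff F e = mcoeff G e) \<Longrightarrow> F = G"
  by (metis ext mcoeff_inject)

definition splits :: "('v \<Rightarrow>\<^sub>0 nat) \<Rightarrow> (('v \<Rightarrow>\<^sub>0 nat) \<times> ('v \<Rightarrow>\<^sub>0 nat)) set" where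
  "splits e = {(a, b). a + b = e}"

lemma finite_splits [simp]: "finite (splits e)"
proof -
  let ?F = "{f. \<forall>v. (v \<in> Poly_Mapping.keys e \<longrightarrow> f v \<in> {..Max (Poly_Mapping.lookup e ` Poly_Mapping.keys e)}) \<and> (v \<notin> Poly_Mapping.keys e \<longrightarrow> f v = (0::nat))}"
  have fin: "finite ?F"
    by (rule finite_set_of_finite_funs) auto
  have "Poly_Mapping.lookup a \<in> ?F" if "a + b = e" for a b
  proof -
    have le: "Poly_Mapping.lookup a v \<le> Poly_Mapping.lookup e v" for v
      using that by (auto simp: lookup_add)
    have "Poly_Mapping.lookup a v \<in> {..Max (Poly_Mapping.lookup e ` Poly_Mapping.keys e)}"
      if "v \<in> Poly_Mapping.keys e" for v
    proof -
      have "Poly_Mapping.lookup e v \<le> Max (Poly_Mapping.lookup e ` Poly_Mapping.keys e)"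
        using that by (intro Max_ge) simp_all
      with le[of v] show ?thesis
        unfolding atMost_iff by (rule order_trans)
    qed
    moreover have "Poly_Mapping.lookup a v = 0" if "v \<notin> Poly_Mapping.keys e" for v
      using le[of v] that by (simp add: in_keys_iff)
    ultimately show ?thesis
      by blast
  qed
  hence "Poly_Mapping.lookup ` fst ` splits e \<subseteq> ?F"
    by (auto simp: splits_def)
  hence "finite (Poly_Mapping.lookup ` fst ` splits e)"
    using fin finite_subset by blast
  hence f: "finite (fst ` splits e)"
    by (rule finite_imageD) (auto simp: inj_on_def)
  have "inj_on fst (splits e)"
    by (auto simp: inj_on_def splits_def)
  with f show ?thesis
    by (rule finite_imageD)
qed

instantiation mfps :: (type, comm_ring_1) comm_ring_1
begin

definition "0 = Abs_mfps (\<lambda>e. 0)"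
definition "1 = Abs_mfps (\<lambda>e. if e = 0 then 1 else 0)"
definition "F + G = Abs_mfps (\<lambda>e. mcoeff F e + mcoeff G e)"
definition "F - G = Abs_mfps (\<lambda>e. mcoeff F e - mcoeff G e)"
definition "- F = Abs_mfps (\<lambda>e. - mcoeff F e)"
definition "F * G = Abs_mfps (\<lambda>e. \<Sum>(a, b)\<in>splits e. mcoeff F a * mcoeff G b)"

instance
proof
  fix F G H :: "('a, 'b) mfps"
  show "F + G + H = F + (G + H)" "F + G = G + F" "0 + F = F" "- F + F = 0" "F - G = F + - G"
    by (auto intro!: mfps_eqI simp: plus_mfps_def zero_mfps_def uminus_mfps_def minus_mfps_def)
  show "F * G = G * F"
  proof (rule mfps_eqI)
    fix e
    show "mcoeff (F * G) e = mcoeff (G * F) e"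
      unfolding times_mfps_def mcoeff_Abs_mfps
      by (rule sum.reindex_bij_witness[where i = "\<lambda>(a, b). (b, a)" and j = "\<lambda>(a, b). (b, a)"])
         (auto simp: splits_def add.commute mult.commute)
  qed
  show "(F + G) * H = F * H + G * H"
    by (rule mfps_eqI)
       (simp add: times_mfps_def plus_mfps_def case_prod_unfold distrib_right sum.distrib)
  show "1 * F = F"
  proof (rule mfps_eqI)
    fix e
    have "mcoeff (1 * F) e = (\<Sum>(a, b)\<in>splits e. (if a = 0 then 1 else 0) * mcoeff F b)"
      by (simp add: times_mfps_def one_mfps_def)
    also have "\<dots> = (\<Sum>(a, b)\<in>{(0 :: 'a \<Rightarrow>\<^sub>0 nat, e)}. (if a = 0 then 1 else 0) * mcoeff F b)"
      by (rule sum.mono_neutral_right[OF finite_splits]) (auto simp: splits_def split: if_splits)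
    finally show "mcoeff (1 * F) e = mcoeff F e"
      by simp
  qed
  show "(0::('a, 'b) mfps) \<noteq> 1"
    by (metis (mono_tags) mcoeff_Abs_mfps one_mfps_def zero_mfps_def zero_neq_one)
  show "F * G * H = F * (G * H)"
  proof (rule mfps_eqI)
    fix e
    have "mcoeff (F * G * H) e =
        (\<Sum>(p, c)\<in>splits e. \<Sum>(a, b)\<in>splits p. mcoeff F a * mcoeff G b * mcoeff H c)"
      by (simp add: times_mfps_def case_prod_unfold sum_distrib_right)
    also have "\<dots> = (\<Sum>((p, c), (a, b))\<in>Sigma (splits e) (\<lambda>(p, c). splits p).
        mcoeff F a * mcoeff G b * mcoeff H c)"
      by (subst sum.Sigma[symmetric]) (auto simp: case_prod_unfold)
    also have "\<dots> = (\<Sum>((a, p), (b, c))\<in>Sigma (splits e) (\<lambda>(a, p). splits p).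
        mcoeff F a * (mcoeff G b * mcoeff H c))"
      by (rule sum.reindex_bij_witness[where
            i = "\<lambda>((a, p), (b, c)). ((a + b, c), (a, b))" and
            j = "\<lambda>((p, c), (a, b)). ((a, b + c), (b, c))"])
         (auto simp: splits_def add.assoc mult.assoc)
    also have "\<dots> = (\<Sum>(a, p)\<in>splits e. \<Sum>(b, c)\<in>splits p. mcoeff F a * (mcoeff G b * mcoeff H c))"
      by (subst sum.Sigma[symmetric]) (auto simp: case_prod_unfold)
    also have "\<dots> = mcoeff (F * (G * H)) e"
      by (simp add: times_mfps_def case_prod_unfold sum_distrib_left)
    finally show "mcoeff (F * G * H) e = mcoeff (F * (G * H)) e" .
  qed
qed

end

definition mconst :: "'a \<Rightarrow> ('v, 'a::comm_ring_1) mfps" where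
  "mconst c = Abs_mfps (\<lambda>e. if e = 0 then c else 0)"

definition mvar :: "'v \<Rightarrow> ('v, 'a::comm_ring_1) mfps" where
  "mvar v = Abs_mfps (\<lambda>e. if e = Poly_Mapping.single v 1 then 1 else 0)"

definition mmap :: "('a \<Rightarrow> 'b) \<Rightarrow> ('v, 'a) mfps \<Rightarrow> ('v, 'b) mfps" where
  "mmap f F = Abs_mfps (\<lambda>e. f (mcoeff F e))"


section \<open>The base field\<close>

text \<open>
  The index set \<open>{1, \<dots>, m}\<close> is rendered as a finite linearly ordered type \<open>'m\<close>, of which
  \<open>m = CARD('m)\<close> is the cardinality. The field of rational functions in \<open>q\<close> and the \<open>u\<^sub>r\<close> is
  realised as the field of rational functions in \<open>q\<close> over the field of rational functions in
  the \<open>u\<^sub>r\<close>.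
\<close>

type_synonym 'm ufield = "(('m \<Rightarrow>\<^sub>0 nat) \<Rightarrow>\<^sub>0 complex) fract"
type_synonym 'm qufield = "'m ufield poly fract"

definition ucoeff :: "'m::{finite,linorder} ufield \<Rightarrow> 'm qufield" where
  "ucoeff c = Fract [:c:] 1"

definition qpar :: "'m::{finite,linorder} qufield" where
  "qpar = Fract [:0, 1:] 1"

definition upar :: "'m::{finite,linorder} \<Rightarrow> 'm qufield" where
  "upar r = ucoeff (Fract (Poly_Mapping.single (Poly_Mapping.single r 1) 1) 1)"

text \<open>The substitution of \<open>q\<inverse>\<close> for \<open>q\<close> in a rational function, with the \<open>u\<^sub>r\<close> fixed.\<close>

definition poly_at_qinv :: "'m::{finite,linorder} ufield poly \<Rightarrow> 'm qufield" where
  "poly_at_qinv f = poly (map_poly ucoeff f) (inverse qpar)"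

definition at_qinv :: "'m::{finite,linorder} qufield \<Rightarrow> 'm qufield" where
  "at_qinv x = (THE y. \<forall>f g. g \<noteq> 0 \<longrightarrow> x = Fract f g \<longrightarrow> y = poly_at_qinv f / poly_at_qinv g)"


section \<open>Arrays and multipartitions\<close>

text \<open>The second index starts at 0 here: \<open>\<alpha> i j\<close> is the entry usually called
  \<open>\<alpha>\<close> with indices \<open>i, j + 1\<close>. Likewise \<open>p j\<close> is the part number \<open>j + 1\<close> of a partition \<open>p\<close>, so
  that a multipartition is literally an array.\<close>

definition arrays :: "('m \<Rightarrow> nat \<Rightarrow> nat) set" where
  "arrays = {\<alpha>. finite {(i, j). \<alpha> i j > 0}}"

definition array_size :: "('m \<Rightarrow> nat \<Rightarrow> nat) \<Rightarrow> nat" where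
  "array_size \<alpha> = (\<Sum>(i, j) | \<alpha> i j > 0. \<alpha> i j)"

definition array_length :: "('m \<Rightarrow> nat \<Rightarrow> nat) \<Rightarrow> nat" where
  "array_length \<alpha> = card {(i, j). \<alpha> i j > 0}"

definition is_partition :: "(nat \<Rightarrow> nat) \<Rightarrow> bool" where
  "is_partition p \<longleftrightarrow> antimono p \<and> finite {j. p j > 0}"

definition part_size :: "(nat \<Rightarrow> nat) \<Rightarrow> nat" where
  "part_size p = (\<Sum>j | p j > 0. p j)"

definition part_length :: "(nat \<Rightarrow> nat) \<Rightarrow> nat" where
  "part_length p = card {j. p j > 0}"

definition part_conj :: "(nat \<Rightarrow> nat) \<Rightarrow> nat \<Rightarrow> nat" where
  "part_conj p j = card {k. p k > j}"

definition multipartitions :: "('m \<Rightarrow> nat \<Rightarrow> nat) set" where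
  "multipartitions = {\<mu>. \<forall>r. is_partition (\<mu> r)}"

definition mpart_size :: "('m::finite \<Rightarrow> nat \<Rightarrow> nat) \<Rightarrow> nat" where
  "mpart_size \<mu> = (\<Sum>r\<in>UNIV. part_size (\<mu> r))"

definition mpart_length :: "('m::finite \<Rightarrow> nat \<Rightarrow> nat) \<Rightarrow> nat" where
  "mpart_length \<mu> = (\<Sum>r\<in>UNIV. part_length (\<mu> r))"

definition mpart_conj :: "('m \<Rightarrow> nat \<Rightarrow> nat) \<Rightarrow> 'm \<Rightarrow> nat \<Rightarrow> nat" where
  "mpart_conj \<mu> r = part_conj (\<mu> r)"


section \<open>Symmetric functions\<close>

text \<open>The variable \<open>(r, k)\<close> is the \<open>k\<close>-th letter of the infinite alphabet with index \<open>r\<close>.\<close>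

definition cells :: "(nat \<Rightarrow> nat) \<Rightarrow> (nat \<times> nat) set" where
  "cells p = {(i, j). j < p i}"

text \<open>Tableaux are set to 0 outside their shape, so that every filling is counted once.\<close>

definition is_ssyt :: "(nat \<Rightarrow> nat) \<Rightarrow> (nat \<Rightarrow> nat \<Rightarrow> nat) \<Rightarrow> bool" where
  "is_ssyt p T \<longleftrightarrow>
     (\<forall>i j. (i, Suc j) \<in> cells p \<longrightarrow> T i j \<le> T i (Suc j)) \<and>
     (\<forall>i j. (Suc i, j) \<in> cells p \<longrightarrow> T i j < T (Suc i) j) \<and>
     (\<forall>i j. (i, j) \<notin> cells p \<longrightarrow> T i j = 0)"

definition ssyt_weight :: "'m \<Rightarrow> (nat \<Rightarrow> nat) \<Rightarrow> (nat \<Rightarrow> nat \<Rightarrow> nat) \<Rightarrow> ('m \<times> nat) \<Rightarrow>\<^sub>0 nat" where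
  "ssyt_weight r p T = (\<Sum>(i, j)\<in>cells p. Poly_Mapping.single (r, T i j) 1)"

definition schur :: "'m \<Rightarrow> (nat \<Rightarrow> nat) \<Rightarrow> ('m \<times> nat, 'a::comm_ring_1) mfps" where
  "schur r p = Abs_mfps (\<lambda>e. of_nat (card {T. is_ssyt p T \<and> ssyt_weight r p T = e}))"

definition mschur :: "('m::finite \<Rightarrow> nat \<Rightarrow> nat) \<Rightarrow> ('m \<times> nat, 'a::comm_ring_1) mfps" where
  "mschur \<mu> = (\<Prod>r\<in>UNIV. schur r (\<mu> r))"

text \<open>
  \<open>hl_gen r t N\<close> is the product of \<open>(1 - t x z) / (1 - x z)\<close> over the first \<open>N\<close> letters \<open>x\<close> of the
  alphabet \<open>r\<close>, as a power series in \<open>z\<close>; the quotient is expanded as a geometric series. For the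
  product over the whole alphabet, every coefficient (of a power of \<open>z\<close> and a monomial in the
  letters) is the eventually constant value of the coefficients of the finite products.
\<close>

definition hl_gen :: "'m \<Rightarrow> 'a \<Rightarrow> nat \<Rightarrow> ('m \<times> nat, 'a::comm_ring_1) mfps fps" where
  "hl_gen r t N = (\<Prod>k<N. (1 - fps_const (mconst t * mvar (r, k)) * fps_X)
                            * Abs_fps (\<lambda>d. mvar (r, k) ^ d))"

definition hl_q :: "'m \<Rightarrow> 'a \<Rightarrow> nat \<Rightarrow> ('m \<times> nat, 'a::comm_ring_1) mfps" where
  "hl_q r t a = Abs_mfps (\<lambda>e. THE c. \<forall>\<^sub>F N in sequentially. mcoeff (fps_nth (hl_gen r t N) a) e = c)"

text \<open>The exponent \<open>card {..<i}\<close> is \<open>i - 1\<close> when the elements of \<open>'m\<close> are numbered \<open>1, \<dots>, m\<close>.\<close>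

definition shoji_q :: "'m::{finite,linorder} \<Rightarrow> nat \<Rightarrow> ('m \<times> nat, 'm qufield) mfps" where
  "shoji_q i a = mconst (qpar ^ a / (qpar - 1)) *
     (\<Sum>c | (\<Sum>r\<in>UNIV. c r) = a.
        mconst (upar (Max {r. c r \<noteq> 0}) ^ card {..<i}) *
        (\<Prod>r\<in>UNIV. hl_q r (inverse qpar) (c r)))"


section \<open>The coefficients and their generating function\<close>

definition schur_coeffs ::
  "('m::finite \<times> nat, 'a::comm_ring_1) mfps \<Rightarrow> ('m \<Rightarrow> nat \<Rightarrow> nat) \<Rightarrow> 'a" where
  "schur_coeffs F = (THE c. finite {\<mu>. c \<mu> \<noteq> 0} \<and> {\<mu>. c \<mu> \<noteq> 0} \<subseteq> multipartitions \<and>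
     F = (\<Sum>\<mu> | c \<mu> \<noteq> 0. mconst (c \<mu>) * mschur \<mu>))"

definition chi ::
  "('m::{finite,linorder} \<Rightarrow> nat \<Rightarrow> nat) \<Rightarrow> ('m \<Rightarrow> nat \<Rightarrow> nat) \<Rightarrow> 'm qufield" where
  "chi lam \<alpha> = schur_coeffs (\<Prod>(i, j) | \<alpha> i j > 0. shoji_q i (\<alpha> i j)) lam"

definition gen_fun ::
  "('m::{finite,linorder} \<Rightarrow> nat \<Rightarrow> nat) \<Rightarrow> ('m \<times> nat, 'm qufield) mfps" where
  "gen_fun lam = Abs_mfps (\<lambda>e. let \<alpha> = (\<lambda>i j. Poly_Mapping.lookup e (i, j))
                              in (qpar - 1) ^ array_length \<alpha> * chi lam \<alpha>)"

end

(*
  Let omega be the involution exchanging s_p and s_{p^t}, in all alphabets at once. Coefficients of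
  the Schur expansion are compared by applying omega to the product of the q_a^{(i)}.

  As q_a(X; t) is the sum of (-t)^k e_k h_{a-k}, the Pieri rules expand q_a s_p over pairs of a
  horizontal and a vertical strip, in either order, and conjugation exchanges the two kinds of strips.
  Hence omega(q_a(X; t) F) = (-t)^a q_a(X; 1/t) omega(F). At t = 1/q the scalars combine to
  omega(q_a^{(i)} F) = (-q)^{a-1} bar(q_a^{(i)}) omega(F), where bar substitutes 1/q for q, and taking
  the product over the support of alpha gives the exponent n - l(alpha).

  The h-Pieri rule is proved for N letters by induction on N, from the branching rule and a bijection
  which exchanges removing and adding horizontal strips. The e-Pieri rule follows from it, from
  sum_k (-1)^k e_k h_{n-k} = 0, and from a sign-reversing toggle of one row.
*)
theory Submission
  imports Defs
begin

section \<open>Multivariate power series\<close>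

text \<open>In infinitely many letters, Schur functions and the q_a are known only coefficient by
  coefficient, which gives an induction nothing to run on. Setting all letters from index N on to
  zero is a ring homomorphism, and doing so for every N loses no information; so identities are
  proved in N letters and then lifted. Both orders of strips are needed because conjugating
  "horizontal, then vertical" gives "vertical, then horizontal". The two match because e_k and
  h_{a-k} commute, so that both orders expand the same product. The involution is not built as a
  map. \<open>omega_pair\<close> relates two series having expansions with shared coefficients, one
  in Schur functions and one in their conjugates. This relation passes through sums, scalars and
  products with \<open>hl_q\<close> without any question of well-definedness; linear independence
  enters only when coefficients are read off. The exponent is a - 1, not a, because the denominator
  contributes too: 1/(1/q - 1) = -q/(q - 1). The parameters u see only the composition c, which
  neither operation changes.\<close>

lemma mcoeff_zero [simp]: "mcoeff 0 e = 0"
  by (simp add: zero_mfps_def)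

lemma mcoeff_one: "mcoeff 1 e = (if e = 0 then 1 else 0)"
  by (simp add: one_mfps_def)

lemma mcoeff_add [simp]: "mcoeff (F + G) e = mcoeff F e + mcoeff G e"
  by (simp add: plus_mfps_def)

lemma mcoeff_diff [simp]: "mcoeff (F - G) e = mcoeff F e - mcoeff G e"
  by (simp add: minus_mfps_def)

lemma mcoeff_uminus [simp]: "mcoeff (- F) e = - mcoeff F e"
  by (simp add: uminus_mfps_def)

lemma mcoeff_mult: "mcoeff (F * G) e = (\<Sum>(a, b)\<in>splits e. mcoeff F a * mcoeff G b)"
  by (simp add: times_mfps_def)

lemma mcoeff_sum [simp]: "mcoeff (sum F A) e = (\<Sum>x\<in>A. mcoeff (F x) e)"
  by (induction A rule: infinite_finite_induct) auto

lemma mcoeff_mconst: "mcoeff (mconst c) e = (if e = 0 then c else 0)"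
  by (simp add: mconst_def)

lemma mcoeff_mconst_mult [simp]: "mcoeff (mconst c * F) e = c * mcoeff F e" for F :: "('v, 'a::comm_ring_1) mfps"
proof -
  have "mcoeff (mconst c * F) e = (\<Sum>(a, b)\<in>{(0 :: 'v \<Rightarrow>\<^sub>0 nat, e)}. mcoeff (mconst c :: ('v, 'a) mfps) a * mcoeff F b)"
    unfolding mcoeff_mult
    by (rule sum.mono_neutral_right[OF finite_splits])
       (auto simp: splits_def mcoeff_mconst split: if_splits)
  thus ?thesis
    by (simp add: mcoeff_mconst)
qed

lemma mconst_0 [simp]: "mconst 0 = 0"
  by (rule mfps_eqI) (simp add: mcoeff_mconst)

lemma mconst_1 [simp]: "mconst 1 = 1"
  by (rule mfps_eqI) (simp add: mcoeff_mconst mcoeff_one)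

lemma mconst_add: "mconst (c + d) = mconst c + mconst d"
  by (rule mfps_eqI) (simp add: mcoeff_mconst)

lemma mconst_mult: "mconst (c * d) = mconst c * mconst d"
  by (rule mfps_eqI) (simp add: mcoeff_mconst)

lemma mconst_uminus: "mconst (- c) = - mconst c"
  by (rule mfps_eqI) (simp add: mcoeff_mconst)

lemma mconst_diff: "mconst (c - d) = mconst c - mconst d"
  by (rule mfps_eqI) (simp add: mcoeff_mconst)

lemma mconst_power: "mconst (c ^ n) = mconst c ^ n"
  by (induction n) (simp_all add: mconst_mult)

definition mmon :: "('v \<Rightarrow>\<^sub>0 nat) \<Rightarrow> ('v, 'a::comm_ring_1) mfps" where
  "mmon e = Abs_mfps (\<lambda>e'. if e' = e then 1 else 0)"

lemma mcoeff_mmon: "mcoeff (mmon e) e' = (if e' = e then 1 else 0)"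
  by (simp add: mmon_def)

lemma mmon_0 [simp]: "mmon 0 = 1"
  by (rule mfps_eqI) (simp add: mcoeff_mmon mcoeff_one)

lemma mmon_add: "mmon (a + b) = mmon a * mmon b"
proof (rule mfps_eqI)
  fix e
  have "mcoeff (mmon a * mmon b :: ('a, 'b) mfps) e =
      (\<Sum>p\<in>splits e. if p = (a, b) then 1 else 0)"
    unfolding mcoeff_mult by (rule sum.cong) (auto simp: mcoeff_mmon split: if_splits)
  also have "\<dots> = (if (a, b) \<in> splits e then 1 else 0)"
    by simp
  finally show "mcoeff (mmon (a + b)) e = mcoeff (mmon a * mmon b :: ('a, 'b) mfps) e"
    by (auto simp: mcoeff_mmon splits_def)
qed

lemma mvar_eq_mmon: "mvar v = mmon (Poly_Mapping.single v 1)"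
  by (simp add: mvar_def mmon_def)

lemma mvar_power: "mvar v ^ n = mmon (Poly_Mapping.single v n)"
  by (induction n) (simp_all add: mvar_eq_mmon mmon_add[symmetric] single_add[symmetric])

text \<open>The ring homomorphism which substitutes 0 for the variables outside \<open>S\<close>.\<close>

definition mrestr :: "'v set \<Rightarrow> ('v, 'a::comm_ring_1) mfps \<Rightarrow> ('v, 'a) mfps" where
  "mrestr S F = Abs_mfps (\<lambda>e. if \<forall>v. v \<notin> S \<longrightarrow> Poly_Mapping.lookup e v = 0 then mcoeff F e else 0)"

lemma mcoeff_mrestr:
  "mcoeff (mrestr S F) e = (if \<forall>v. v \<notin> S \<longrightarrow> Poly_Mapping.lookup e v = 0 then mcoeff F e else 0)"
  by (simp add: mrestr_def)

lemma mrestr_0 [simp]: "mrestr S 0 = 0"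
  by (rule mfps_eqI) (auto simp: mcoeff_mrestr)

lemma mrestr_1 [simp]: "mrestr S 1 = 1"
  by (rule mfps_eqI) (auto simp: mcoeff_mrestr mcoeff_one)

lemma mrestr_add: "mrestr S (F + G) = mrestr S F + mrestr S G"
  by (rule mfps_eqI) (auto simp: mcoeff_mrestr)

lemma mrestr_sum: "mrestr S (sum F A) = (\<Sum>x\<in>A. mrestr S (F x))"
  by (induction A rule: infinite_finite_induct) (simp_all add: mrestr_add)

lemma mrestr_mconst_mult: "mrestr S (mconst c * F) = mconst c * mrestr S F"
  by (rule mfps_eqI) (auto simp: mcoeff_mrestr)

text \<open>Exponents are natural numbers, so a sum of two of them vanishes outside \<open>S\<close>
  exactly when both summands do.\<close>

lemma mrestr_mult: "mrestr S (F * G) = mrestr S F * mrestr S G"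
proof (rule mfps_eqI)
  fix e
  show "mcoeff (mrestr S (F * G)) e = mcoeff (mrestr S F * mrestr S G) e"
  proof (cases "\<forall>v. v \<notin> S \<longrightarrow> Poly_Mapping.lookup e v = 0")
    case True
    hence "\<forall>v. v \<notin> S \<longrightarrow> Poly_Mapping.lookup a v = 0 \<and> Poly_Mapping.lookup b v = 0"
      if "(a, b) \<in> splits e" for a b
      using that by (auto simp: splits_def lookup_add)
    hence "mcoeff (mrestr S F * mrestr S G) e = mcoeff (F * G) e"
      unfolding mcoeff_mult by (intro sum.cong) (auto simp: mcoeff_mrestr)
    with True show ?thesis
      by (simp add: mcoeff_mrestr)
  next
    case False
    hence "\<not> ((\<forall>v. v \<notin> S \<longrightarrow> Poly_Mapping.lookup a v = 0) \<and>
              (\<forall>v. v \<notin> S \<longrightarrow> Poly_Mapping.lookup b v = 0))"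
      if "(a, b) \<in> splits e" for a b
      using that by (fastforce simp: splits_def lookup_add)
    hence "mcoeff (mrestr S F) a * mcoeff (mrestr S G) b = 0" if "(a, b) \<in> splits e" for a b
      using that by (auto simp: mcoeff_mrestr simp del: not_all)
    hence "mcoeff (mrestr S F * mrestr S G) e = 0"
      unfolding mcoeff_mult by (intro sum.neutral) auto
    with False show ?thesis
      by (auto simp: mcoeff_mrestr)
  qed
qed

lemma mrestr_power: "mrestr S (F ^ n) = mrestr S F ^ n"
  by (induction n) (simp_all add: mrestr_mult)

lemma mrestr_mmon:
  "mrestr S (mmon e) = (if \<forall>v. v \<notin> S \<longrightarrow> Poly_Mapping.lookup e v = 0 then mmon e else 0)"
  by (rule mfps_eqI) (auto simp: mcoeff_mrestr mcoeff_mmon)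

lemma mrestr_mvar: "mrestr S (mvar v) = (if v \<in> S then mvar v else 0)"
  by (auto simp: mvar_eq_mmon mrestr_mmon lookup_single when_def)

text \<open>A monomial contains finitely many letters, so each coefficient is already visible after
  restriction to enough of them. This lifts identities in N letters to whole alphabets.\<close>

lemma mfps_eq_mrestrI:
  assumes "\<And>N::nat. mrestr (UNIV \<times> {..<N}) F = mrestr (UNIV \<times> {..<N}) G"
  shows "F = (G :: ('m \<times> nat, 'a::comm_ring_1) mfps)"
proof (rule mfps_eqI)
  fix e :: "'m \<times> nat \<Rightarrow>\<^sub>0 nat"
  \<comment> \<open>For empty support this \<open>Max\<close> is an unspecified number; the bound is
    applied only to a letter in the support.\<close>
  define N where "N = Suc (Max (snd ` Poly_Mapping.keys e))"
  have "\<forall>v. v \<notin> UNIV \<times> {..<N} \<longrightarrow> Poly_Mapping.lookup e v = 0"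
  proof (intro allI impI, rule ccontr)
    fix v
    assume v: "v \<notin> UNIV \<times> {..<N}" "Poly_Mapping.lookup e v \<noteq> 0"
    hence "snd v \<in> snd ` Poly_Mapping.keys e"
      by (simp add: in_keys_iff)
    hence "snd v < N"
      unfolding N_def by (simp add: le_imp_less_Suc)
    with v show False
      by (cases v) auto
  qed
  thus "mcoeff F e = mcoeff G e"
    using arg_cong[OF assms[of N], of "\<lambda>F. mcoeff F e"] by (simp add: mcoeff_mrestr)
qed

section \<open>Ring homomorphisms acting on coefficients\<close>

lemma mcoeff_mmap [simp]: "mcoeff (mmap f F) e = f (mcoeff F e)"
  by (simp add: mmap_def)

text \<open>Abstracts from the substitution of 1/q for q what is needed to push it through products
  and Schur expansions.\<close>

locale ring_hom_on_coeffs =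
  fixes f :: "'a::comm_ring_1 \<Rightarrow> 'b::comm_ring_1"
  assumes zero: "f 0 = 0" and one: "f 1 = 1"
    and add: "f (x + y) = f x + f y" and mult: "f (x * y) = f x * f y"
begin

lemma sum: "f (sum g A) = (\<Sum>x\<in>A. f (g x))"
  by (induction A rule: infinite_finite_induct) (simp_all add: zero add)

lemma mmap_1: "mmap f 1 = 1"
  by (rule mfps_eqI) (simp add: mcoeff_one one zero)

lemma mmap_mult: "mmap f (F * G) = mmap f F * mmap f G"
  by (rule mfps_eqI) (simp add: mcoeff_mult case_prod_unfold sum mult)

lemma mmap_sum: "mmap f (sum F A) = (\<Sum>x\<in>A. mmap f (F x))"
  by (rule mfps_eqI) (simp add: sum)

lemma mmap_prod: "mmap f (prod F A) = (\<Prod>x\<in>A. mmap f (F x))"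
  by (induction A rule: infinite_finite_induct) (simp_all add: mmap_1 mmap_mult)

lemma mmap_mconst: "mmap f (mconst c) = mconst (f c)"
  by (rule mfps_eqI) (simp add: mcoeff_mconst zero)

lemma mmap_mvar: "mmap f (mvar v) = mvar v"
  by (rule mfps_eqI) (simp add: mvar_eq_mmon mcoeff_mmon one zero)

text \<open>The coefficients count tableaux, and a ring homomorphism preserves the images of natural
  numbers.\<close>

lemma mmap_schur: "mmap f (schur r p) = schur r p"
proof (rule mfps_eqI)
  have "f (of_nat n) = of_nat n" for n
    by (induction n) (simp_all add: zero one add)
  thus "mcoeff (mmap f (schur r p)) e = mcoeff (schur r p) e" for e
    by (simp add: schur_def)
qed

lemma mmap_mschur: "mmap f (mschur \<mu>) = mschur \<mu>"
  by (simp add: mschur_def mmap_prod mmap_schur)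

end

section \<open>Partitions and strips\<close>

lemma is_partitionD: "is_partition p \<Longrightarrow> i \<le> j \<Longrightarrow> p j \<le> p i"
  by (auto simp: is_partition_def antimono_def)

lemma support_subset:
  fixes p :: "nat \<Rightarrow> nat"
  assumes "\<And>i. i \<ge> L \<Longrightarrow> p i = 0"
  shows "{j. p j > 0} \<subseteq> {..<L}"
proof
  fix j assume "j \<in> {j. p j > 0}"
  thus "j \<in> {..<L}"
    using assms[of j] by (cases "L \<le> j") auto
qed

lemma is_partition_bound:
  assumes "is_partition p"
  obtains L where "\<And>i. i \<ge> L \<Longrightarrow> p i = 0"
proof -
  have "finite {j. p j > 0}"
    using assms by (simp add: is_partition_def)
  then obtain L where "\<forall>j\<in>{j. p j > 0}. j < L"
    by (meson finite_nat_set_iff_bounded)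
  thus ?thesis
    by (intro that[of L]) (use leD in auto)
qed

lemma is_partitionI:
  assumes "\<And>i. p (Suc i) \<le> p i" "\<And>i. i \<ge> L \<Longrightarrow> p i = 0"
  shows "is_partition p"
proof -
  have "antimono p"
    by (simp add: antimono_iff_le_Suc assms)
  moreover have "{j. p j > 0} \<subseteq> {..<L}"
    by (rule support_subset) (rule assms(2))
  ultimately show ?thesis
    by (auto simp: is_partition_def intro: finite_subset)
qed

lemma part_size_eq_sum:
  assumes "\<And>i. i \<ge> L \<Longrightarrow> p i = 0"
  shows "part_size p = (\<Sum>i<L. p i)"
proof -
  have "{j. p j > 0} \<subseteq> {..<L}"
    by (rule support_subset) (rule assms)
  thus ?thesis
    unfolding part_size_def by (intro sum.mono_neutral_left) auto
qed

lemma cells_eq_Sigma: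
  assumes "\<And>i. i \<ge> L \<Longrightarrow> p i = 0"
  shows "cells p = (SIGMA i:{..<L}. {..<p i})"
proof -
  have "i < L" if "j < p i" for i j
    using assms[of i] that by (cases "i < L") auto
  thus ?thesis
    by (auto simp: cells_def)
qed

lemma finite_cells: "is_partition p \<Longrightarrow> finite (cells p)"
  by (erule is_partition_bound, subst cells_eq_Sigma, assumption, simp)

lemma card_cells: "is_partition p \<Longrightarrow> card (cells p) = part_size p"
  by (erule is_partition_bound, subst cells_eq_Sigma, assumption, subst part_size_eq_sum, assumption, simp)

text \<open>Such a partition has at most \<open>n\<close> nonzero rows, each of length at most
  \<open>n\<close>.\<close>

lemma finite_partitions: "finite {p. is_partition p \<and> part_size p \<le> n}"
proof -
  let ?F = "{f. \<forall>x. (x \<in> {..<n} \<longrightarrow> f x \<in> {..n}) \<and> (x \<notin> {..<n} \<longrightarrow> f x = (0::nat))}"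
  have "p \<in> ?F" if p: "is_partition p" "part_size p \<le> n" for p
  proof -
    obtain L where L: "\<And>i. i \<ge> L \<Longrightarrow> p i = 0"
      using is_partition_bound[OF p(1)] by blast
    have "p i \<le> n" for i
    proof (cases "i < L")
      case True
      hence "p i \<le> (\<Sum>i<L. p i)"
        by (intro member_le_sum) auto
      thus ?thesis
        using p L by (simp add: part_size_eq_sum[of L])
    qed (use L in auto)
    moreover have "p i = 0" if "i \<ge> n" for i
    proof (rule ccontr)
      assume "p i \<noteq> 0"
      hence pos: "p j \<ge> 1" if "j \<le> i" for j
        using is_partitionD[OF p(1) that] by simp
      have "i < L"
        using L[of i] \<open>p i \<noteq> 0\<close> by (cases "i < L") auto
      have "Suc i = (\<Sum>j<Suc i. 1)"
        by simp
      also have "\<dots> \<le> (\<Sum>j<Suc i. p j)"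
        by (intro sum_mono) (use pos in auto)
      also have "\<dots> \<le> (\<Sum>j<L. p j)"
        by (intro sum_mono2) (use \<open>i < L\<close> in auto)
      also have "\<dots> \<le> n"
        using p L by (simp add: part_size_eq_sum[of L])
      finally show False
        using that by simp
    qed
    ultimately show ?thesis
      by (simp add: not_less)
  qed
  moreover have "finite ?F"
    by (rule finite_set_of_finite_funs) auto
  ultimately show ?thesis
    by (metis (mono_tags, lifting) finite_subset mem_Collect_eq subsetI)
qed

text \<open>Since \<open>p\<close> decreases, the rows longer than \<open>j\<close> form an initial
  segment, whose length is that of column \<open>j\<close>. In this form, as a transposition of
  cells, conjugation is accessible to all later arguments.\<close>

lemma less_part_conj_iff:
  assumes "is_partition p"
  shows "i < part_conj p j \<longleftrightarrow> j < p i"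
proof -
  obtain L where L: "\<And>i. i \<ge> L \<Longrightarrow> p i = 0"
    using is_partition_bound[OF assms] by blast
  define m where "m = (LEAST k. p k \<le> j)"
  have m: "p m \<le> j"
    unfolding m_def by (rule LeastI[of _ L]) (simp add: L)
  have "j < p k \<longleftrightarrow> k < m" for k
    using m is_partitionD[OF assms, of m k] not_less_Least[of k "\<lambda>k. p k \<le> j"]
    by (auto simp: m_def[symmetric]) (meson leD le_less_linear order_trans)
  hence *: "k < m \<longleftrightarrow> j < p k" for k
    by simp
  have "{k. p k > j} = {..<m}"
    using * by auto
  hence "part_conj p j = m"
    by (simp add: part_conj_def)
  thus ?thesis
    by (simp add: *)
qed

lemma is_partition_conj:
  assumes "is_partition p"
  shows "is_partition (part_conj p)"
proof (rule is_partitionI[where L = "p 0"])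
  show "part_conj p (Suc j) \<le> part_conj p j" for j
    using less_part_conj_iff[OF assms, of "part_conj p j" j]
      less_part_conj_iff[OF assms, of "part_conj p j" "Suc j"] by simp
  show "part_conj p j = 0" if "p 0 \<le> j" for j
    using less_part_conj_iff[OF assms, of 0 j] that by simp
qed

lemma part_conj_conj:
  assumes "is_partition p"
  shows "part_conj (part_conj p) = p"
proof
  fix i
  have "k < part_conj (part_conj p) i \<longleftrightarrow> k < p i" for k
    by (simp add: less_part_conj_iff is_partition_conj assms)
  thus "part_conj (part_conj p) i = p i"
    by (meson linorder_neq_iff)
qed

lemma part_size_conj:
  assumes "is_partition p"
  shows "part_size (part_conj p) = part_size p"
proof -
  have "bij_betw prod.swap (cells p) (cells (part_conj p))"
    by (rule bij_betw_byWitness[where f' = prod.swap])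
       (auto simp: cells_def less_part_conj_iff assms)
  thus ?thesis
    using card_cells[OF assms] card_cells[OF is_partition_conj[OF assms]] bij_betw_same_card
    by metis
qed

text \<open>Interlacing of rows: no column gains two cells. The inequalities force both sequences to
  decrease, which the vertical condition below does not.\<close>

definition hstrip :: "(nat \<Rightarrow> nat) \<Rightarrow> (nat \<Rightarrow> nat) \<Rightarrow> bool" where
  "hstrip p \<nu> \<longleftrightarrow> (\<forall>i. p i \<le> \<nu> i \<and> \<nu> (Suc i) \<le> p i)"

definition vstrip :: "(nat \<Rightarrow> nat) \<Rightarrow> (nat \<Rightarrow> nat) \<Rightarrow> bool" where
  "vstrip p \<nu> \<longleftrightarrow> (\<forall>i. p i \<le> \<nu> i \<and> \<nu> i \<le> Suc (p i))"

definition hstrips :: "nat \<Rightarrow> (nat \<Rightarrow> nat) \<Rightarrow> (nat \<Rightarrow> nat) set" where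
  "hstrips a p = {\<nu>. is_partition \<nu> \<and> hstrip p \<nu> \<and> part_size \<nu> = part_size p + a}"

definition vstrips :: "nat \<Rightarrow> (nat \<Rightarrow> nat) \<Rightarrow> (nat \<Rightarrow> nat) set" where
  "vstrips a p = {\<nu>. is_partition \<nu> \<and> vstrip p \<nu> \<and> part_size \<nu> = part_size p + a}"

lemma finite_hstrips [simp]: "finite (hstrips a p)"
  by (rule finite_subset[OF _ finite_partitions[of "part_size p + a"]]) (auto simp: hstrips_def)

lemma finite_vstrips [simp]: "finite (vstrips a p)"
  by (rule finite_subset[OF _ finite_partitions[of "part_size p + a"]]) (auto simp: vstrips_def)

lemma part_conj_mono_iff:
  assumes "is_partition p" "is_partition \<nu>"
  shows "(\<forall>j. part_conj p j \<le> part_conj \<nu> j) \<longleftrightarrow> (\<forall>i. p i \<le> \<nu> i)"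
proof -
  have "(\<forall>j. part_conj p j \<le> part_conj \<nu> j) \<longleftrightarrow> (\<forall>j i. i < part_conj p j \<longrightarrow> i < part_conj \<nu> j)"
    by (meson leI less_le_trans order_less_irrefl)
  also have "\<dots> \<longleftrightarrow> (\<forall>j i. j < p i \<longrightarrow> j < \<nu> i)"
    by (simp add: less_part_conj_iff assms)
  also have "\<dots> \<longleftrightarrow> (\<forall>i. p i \<le> \<nu> i)"
    by (meson leI less_le_trans order_less_irrefl)
  finally show ?thesis .
qed

text \<open>Apart from containment, both sides say that a cell of \<open>\<nu>\<close> in row
  \<open>Suc i\<close> lies below a cell of \<open>p\<close> in row \<open>i\<close>.\<close>

lemma vstrip_conj_iff:
  assumes "is_partition p" "is_partition \<nu>"
  shows "vstrip (part_conj p) (part_conj \<nu>) \<longleftrightarrow> hstrip p \<nu>"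
proof -
  have "(\<forall>j. part_conj \<nu> j \<le> Suc (part_conj p j)) \<longleftrightarrow>
      (\<forall>j i. Suc i < part_conj \<nu> j \<longrightarrow> i < part_conj p j)"
    by (meson Suc_le_eq Suc_less_eq leI less_Suc_eq_le less_le_trans nat_less_le not_less_eq)
  also have "\<dots> \<longleftrightarrow> (\<forall>j i. j < \<nu> (Suc i) \<longrightarrow> j < p i)"
    by (simp add: less_part_conj_iff assms)
  also have "\<dots> \<longleftrightarrow> (\<forall>i. \<nu> (Suc i) \<le> p i)"
    by (meson leI less_le_trans order_less_irrefl)
  finally show ?thesis
    using part_conj_mono_iff[OF assms] by (auto simp: hstrip_def vstrip_def)
qed

lemma hstrip_conj_iff:
  assumes "is_partition p" "is_partition \<nu>"
  shows "hstrip (part_conj p) (part_conj \<nu>) \<longleftrightarrow> vstrip p \<nu>"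
  using vstrip_conj_iff[OF is_partition_conj[OF assms(1)] is_partition_conj[OF assms(2)]]
  by (simp add: part_conj_conj assms)

lemma bij_betw_conj_hstrips:
  assumes "is_partition p"
  shows "bij_betw part_conj (hstrips a p) (vstrips a (part_conj p))"
proof (rule bij_betw_byWitness[where f' = part_conj])
  show "part_conj ` vstrips a (part_conj p) \<subseteq> hstrips a p"
    using hstrip_conj_iff[OF is_partition_conj[OF assms]]
    by (auto simp: hstrips_def vstrips_def is_partition_conj part_size_conj assms part_conj_conj)
qed (auto simp: hstrips_def vstrips_def part_conj_conj is_partition_conj part_size_conj
      vstrip_conj_iff assms)

lemma bij_betw_conj_vstrips:
  assumes "is_partition p"
  shows "bij_betw part_conj (vstrips a p) (hstrips a (part_conj p))"
proof (rule bij_betw_byWitness[where f' = part_conj])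
  show "part_conj ` hstrips a (part_conj p) \<subseteq> vstrips a p"
    using vstrip_conj_iff[OF is_partition_conj[OF assms]]
    by (auto simp: hstrips_def vstrips_def is_partition_conj part_size_conj assms part_conj_conj)
qed (auto simp: hstrips_def vstrips_def part_conj_conj is_partition_conj part_size_conj
      hstrip_conj_iff assms)

section \<open>Schur functions in finitely many letters\<close>

definition tabs :: "nat \<Rightarrow> (nat \<Rightarrow> nat) \<Rightarrow> (nat \<Rightarrow> nat \<Rightarrow> nat) set" where
  "tabs N p = {T. is_ssyt p T \<and> (\<forall>i j. j < p i \<longrightarrow> T i j < N)}"

abbreviation letters :: "nat \<Rightarrow> ('m \<times> nat) set" where
  "letters N \<equiv> UNIV \<times> {..<N}"

definition schurN :: "'m \<Rightarrow> nat \<Rightarrow> (nat \<Rightarrow> nat) \<Rightarrow> ('m \<times> nat, 'a::comm_ring_1) mfps" where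
  "schurN r N p = mrestr (letters N) (schur r p)"

lemma in_cells_iff [simp]: "(i, j) \<in> cells p \<longleftrightarrow> j < p i"
  by (simp add: cells_def)

lemma finite_tabs:
  assumes "is_partition p"
  shows "finite (tabs N p)"
proof -
  let ?F = "{f. \<forall>x. (x \<in> cells p \<longrightarrow> f x \<in> {..<N}) \<and> (x \<notin> cells p \<longrightarrow> f x = (0::nat))}"
  have "T \<in> curry ` ?F" if "T \<in> tabs N p" for T
  proof (rule image_eqI)
    show "T = curry (case_prod T)"
      by simp
    show "case_prod T \<in> ?F"
      using that by (auto simp: tabs_def is_ssyt_def)
  qed
  hence "tabs N p \<subseteq> curry ` ?F"
    by blast
  moreover have "finite ?F"
    by (rule finite_set_of_finite_funs) (use finite_cells[OF assms] in auto)
  ultimately show ?thesis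
    by (meson finite_imageI finite_subset)
qed

lemma lookup_ssyt_weight:
  assumes "is_partition p"
  shows "Poly_Mapping.lookup (ssyt_weight r p T) v =
           card {(i, j). (i, j) \<in> cells p \<and> (r, T i j) = v}"
proof -
  have "Poly_Mapping.lookup (ssyt_weight r p T) v =
      (\<Sum>x\<in>cells p. if (r, T (fst x) (snd x)) = v then 1 else 0)"
    unfolding ssyt_weight_def lookup_sum
    by (rule sum.cong) (auto simp: lookup_single when_def)
  also have "\<dots> = card {x \<in> cells p. (r, T (fst x) (snd x)) = v}"
    by (subst sum.inter_filter[symmetric]) (use finite_cells[OF assms] in auto)
  also have "{x \<in> cells p. (r, T (fst x) (snd x)) = v} = {(i, j). (i, j) \<in> cells p \<and> (r, T i j) = v}"
    by auto
  finally show ?thesis .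
qed

lemma lookup_ssyt_weight_pos_iff:
  assumes "is_partition p"
  shows "Poly_Mapping.lookup (ssyt_weight r p T) v > 0 \<longleftrightarrow> (\<exists>i j. j < p i \<and> v = (r, T i j))"
proof -
  have "finite {(i, j). (i, j) \<in> cells p \<and> (r, T i j) = v}"
    by (rule finite_subset[OF _ finite_cells[OF assms]]) auto
  thus ?thesis
    unfolding lookup_ssyt_weight[OF assms] by (subst card_gt_0_iff) auto
qed

text \<open>Setting letters to zero keeps exactly the tableaux that avoid them. The result is a
  finite sum over tableaux, on which bijections can act.\<close>

lemma schurN_eq_sum:
  assumes "is_partition p"
  shows "schurN r N p = (\<Sum>T\<in>tabs N p. mmon (ssyt_weight r p T))"
proof (rule mfps_eqI)
  fix e :: "'a \<times> nat \<Rightarrow>\<^sub>0 nat"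
  let ?S = "\<forall>v. v \<notin> letters N \<longrightarrow> Poly_Mapping.lookup e v = 0"
  have supp: "T \<in> tabs N p \<longleftrightarrow> ?S" if "is_ssyt p T" "ssyt_weight r p T = e" for T
  proof -
    have "?S \<longleftrightarrow> (\<forall>v. Poly_Mapping.lookup e v > 0 \<longrightarrow> v \<in> letters N)"
      by (metis gr0I less_numeral_extra(3))
    also have "\<dots> \<longleftrightarrow> (\<forall>i j. j < p i \<longrightarrow> T i j < N)"
      unfolding that(2)[symmetric] lookup_ssyt_weight_pos_iff[OF assms] by auto
    finally show ?thesis
      using that by (simp add: tabs_def)
  qed
  have "mcoeff (\<Sum>T\<in>tabs N p. mmon (ssyt_weight r p T) :: ('a \<times> nat, 'b) mfps) e =
      of_nat (card {T \<in> tabs N p. ssyt_weight r p T = e})"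
    using finite_tabs[OF assms, of N] by (simp add: mcoeff_mmon eq_commute[of e] sum.If_cases Int_def)
  also have "{T \<in> tabs N p. ssyt_weight r p T = e} =
      (if ?S then {T. is_ssyt p T \<and> ssyt_weight r p T = e} else {})"
    using supp by (auto simp: tabs_def)
  also have "of_nat (card \<dots>) = mcoeff (schurN r N p :: ('a \<times> nat, 'b) mfps) e"
    by (auto simp: schurN_def mcoeff_mrestr schur_def)
  finally show "mcoeff (schurN r N p) e =
      mcoeff (\<Sum>T\<in>tabs N p. mmon (ssyt_weight r p T) :: ('a \<times> nat, 'b) mfps) e" ..
qed

section \<open>Branching: removing the largest letter\<close>

lemma hstrip_partition:
  assumes "hstrip \<kappa> p" "is_partition p"
  shows "is_partition \<kappa>"
proof -
  obtain L where "\<And>i. i \<ge> L \<Longrightarrow> p i = 0"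
    using is_partition_bound[OF assms(2)] by blast
  thus ?thesis
    using assms(1) unfolding hstrip_def
    by (intro is_partitionI[where L = L]) (meson order_trans, metis le_zero_eq)
qed

lemma part_size_mono:
  assumes "\<And>i. p i \<le> q i" "is_partition q"
  shows "part_size p \<le> part_size q"
proof -
  obtain L where L: "\<And>i. i \<ge> L \<Longrightarrow> q i = 0"
    using is_partition_bound[OF assms(2)] by blast
  hence "\<And>i. i \<ge> L \<Longrightarrow> p i = 0"
    by (metis assms(1) le_zero_eq)
  with L show ?thesis
    by (simp add: part_size_eq_sum[of L] sum_mono assms)
qed

lemma finite_hstrip_lower:
  assumes "is_partition p"
  shows "finite {\<kappa>. hstrip \<kappa> p}"
  by (rule finite_subset[OF _ finite_partitions[of "part_size p"]])
     (use hstrip_partition[OF _ assms] part_size_mono[OF _ assms] in \<open>auto simp: hstrip_def\<close>)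

lemma ssyt_row_mono:
  assumes "is_ssyt p T" "j \<le> j'" "j' < p i"
  shows "T i j \<le> T i j'"
  using assms(2,3)
proof (induction rule: dec_induct)
  case (step k)
  have "T i k \<le> T i (Suc k)"
    using assms(1) step.prems by (auto simp: is_ssyt_def)
  with step show ?case
    by simp
qed simp

text \<open>The letters smaller than \<open>N\<close> in a tableau form a tableau whose shape is obtained by
  removing a horizontal strip.\<close>

definition small_shape :: "nat \<Rightarrow> (nat \<Rightarrow> nat) \<Rightarrow> (nat \<Rightarrow> nat \<Rightarrow> nat) \<Rightarrow> nat \<Rightarrow> nat" where
  "small_shape N p T i = card {j. j < p i \<and> T i j < N}"

text \<open>Rows increase weakly, so the entries below \<open>N\<close> form an initial segment of
  each row, and counting them locates its end.\<close>

lemma less_small_shape_iff: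
  assumes "is_ssyt p T"
  shows "j < small_shape N p T i \<longleftrightarrow> j < p i \<and> T i j < N"
proof -
  define A where "A = {j. j < p i \<and> T i j < N}"
  have fin: "finite A"
    by (rule finite_subset[of _ "{..<p i}"]) (auto simp: A_def)
  have down: "k \<in> A" if "k \<le> l" "l \<in> A" for k l
    using that ssyt_row_mono[OF assms, of k l i] by (auto simp: A_def)
  have "A = {..<card A}"
  proof (cases "A = {}")
    case False
    have "A = {..Max A}"
    proof
      show "{..Max A} \<subseteq> A"
        using down Max_in[OF fin False] by auto
    qed (use fin in auto)
    thus ?thesis
      by (metis card_atMost lessThan_Suc_atMost)
  qed simp
  hence "j < card A \<longleftrightarrow> j \<in> A"
    by auto
  thus ?thesis
    by (simp add: A_def small_shape_def)
qed

definition restrict_tab :: "(nat \<Rightarrow> nat) \<Rightarrow> (nat \<Rightarrow> nat \<Rightarrow> nat) \<Rightarrow> nat \<Rightarrow> nat \<Rightarrow> nat" where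
  "restrict_tab \<kappa> T i j = (if j < \<kappa> i then T i j else 0)"

definition extend_tab ::
  "nat \<Rightarrow> (nat \<Rightarrow> nat) \<Rightarrow> (nat \<Rightarrow> nat) \<Rightarrow> (nat \<Rightarrow> nat \<Rightarrow> nat) \<Rightarrow> nat \<Rightarrow> nat \<Rightarrow> nat" where
  "extend_tab N p \<kappa> T i j = (if j < \<kappa> i then T i j else if j < p i then N else 0)"

text \<open>Columns increase strictly, so an entry with a cell below it cannot be the largest letter
  \<open>N\<close>; hence each cell of the next row lies below a cell of the smaller shape.\<close>

lemma hstrip_small_shape:
  assumes "T \<in> tabs (Suc N) p" "is_partition p"
  shows "hstrip (small_shape N p T) p"
proof -
  have T: "is_ssyt p T" and lt: "\<And>i j. j < p i \<Longrightarrow> T i j < Suc N"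
    using assms(1) by (auto simp: tabs_def)
  have "small_shape N p T i \<le> p i" for i
    using less_small_shape_iff[OF T, of "p i" N i] by auto
  moreover have "p (Suc i) \<le> small_shape N p T i" for i
  proof (rule ccontr)
    define j where "j = small_shape N p T i"
    assume "\<not> p (Suc i) \<le> small_shape N p T i"
    hence j: "j < p (Suc i)"
      by (simp add: j_def)
    hence "T i j < T (Suc i) j"
      using T by (auto simp: is_ssyt_def)
    with lt[OF j] have "T i j < N"
      by simp
    moreover have "j < p i"
      using j is_partitionD[OF assms(2), of i "Suc i"] by simp
    ultimately have "j < small_shape N p T i"
      by (simp add: less_small_shape_iff[OF T])
    thus False
      by (simp add: j_def)
  qed
  ultimately show ?thesis
    by (simp add: hstrip_def)
qed

lemma restrict_tab_in_tabs:
  assumes "T \<in> tabs (Suc N) p"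
  shows "restrict_tab (small_shape N p T) T \<in> tabs N (small_shape N p T)"
proof -
  have T: "is_ssyt p T"
    using assms by (auto simp: tabs_def)
  have *: "restrict_tab (small_shape N p T) T i j = (if j < p i \<and> T i j < N then T i j else 0)" for i j
    by (simp add: restrict_tab_def less_small_shape_iff[OF T])
  have row: "T i j \<le> T i (Suc j)" if "Suc j < p i" for i j
    using T that by (auto simp: is_ssyt_def)
  have col: "T i j < T (Suc i) j" if "j < p (Suc i)" for i j
    using T that by (auto simp: is_ssyt_def)
  show ?thesis
    unfolding tabs_def is_ssyt_def mem_Collect_eq in_cells_iff less_small_shape_iff[OF T] *
    using row col by (auto dest!: row col) 
qed

lemma extend_tab_in_tabs:
  assumes "T \<in> tabs N \<kappa>" "hstrip \<kappa> p"
  shows "extend_tab N p \<kappa> T \<in> tabs (Suc N) p"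
proof -
  have T: "is_ssyt \<kappa> T" and lt: "\<And>i j. j < \<kappa> i \<Longrightarrow> T i j < N"
    using assms(1) by (auto simp: tabs_def)
  have le: "\<kappa> i \<le> p i" "p (Suc i) \<le> \<kappa> i" for i
    using assms(2) by (auto simp: hstrip_def)
  have row: "T i j \<le> T i (Suc j)" if "Suc j < \<kappa> i" for i j
    using T that by (auto simp: is_ssyt_def)
  have col: "T i j < T (Suc i) j" if "j < \<kappa> (Suc i)" for i j
    using T that by (auto simp: is_ssyt_def)
  have "extend_tab N p \<kappa> T i j < extend_tab N p \<kappa> T (Suc i) j" if "j < p (Suc i)" for i j
    using that le(2)[of i] lt[of j i] col[of j i] by (auto simp: extend_tab_def)
  moreover have "extend_tab N p \<kappa> T i j \<le> extend_tab N p \<kappa> T i (Suc j)" if "Suc j < p i" for i j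
    using that lt[of j i] row[of j i] by (auto simp: extend_tab_def)
  moreover have "extend_tab N p \<kappa> T i j = 0" if "\<not> j < p i" for i j
    using that le(1)[of i] by (auto simp: extend_tab_def)
  moreover have "extend_tab N p \<kappa> T i j < Suc N" if "j < p i" for i j
    using lt[of j i] by (auto simp: extend_tab_def)
  ultimately show ?thesis
    by (simp add: tabs_def is_ssyt_def)
qed

lemma extend_restrict_tab:
  assumes "T \<in> tabs (Suc N) p"
  shows "extend_tab N p (small_shape N p T) (restrict_tab (small_shape N p T) T) = T"
proof (intro ext)
  fix i j
  have T: "is_ssyt p T" and lt: "j < p i \<Longrightarrow> T i j < Suc N"
    using assms by (auto simp: tabs_def)
  have "\<not> j < p i \<Longrightarrow> T i j = 0"
    using T by (auto simp: is_ssyt_def)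
  with lt show "extend_tab N p (small_shape N p T) (restrict_tab (small_shape N p T) T) i j = T i j"
    by (auto simp: extend_tab_def restrict_tab_def less_small_shape_iff[OF T])
qed

lemma small_shape_extend_tab:
  assumes "T \<in> tabs N \<kappa>" "hstrip \<kappa> p"
  shows "small_shape N p (extend_tab N p \<kappa> T) = \<kappa>"
proof
  fix i
  have E: "is_ssyt p (extend_tab N p \<kappa> T)"
    using extend_tab_in_tabs[OF assms] by (simp add: tabs_def)
  have "\<kappa> i \<le> p i" "\<And>j. j < \<kappa> i \<Longrightarrow> T i j < N"
    using assms by (auto simp: hstrip_def tabs_def)
  hence "j < small_shape N p (extend_tab N p \<kappa> T) i \<longleftrightarrow> j < \<kappa> i" for j
    unfolding less_small_shape_iff[OF E] by (auto simp: extend_tab_def)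
  thus "small_shape N p (extend_tab N p \<kappa> T) i = \<kappa> i"
    by (meson linorder_neq_iff)
qed

lemma restrict_extend_tab:
  assumes "T \<in> tabs N \<kappa>"
  shows "restrict_tab \<kappa> (extend_tab N p \<kappa> T) = T"
  using assms by (intro ext) (auto simp: restrict_tab_def extend_tab_def tabs_def is_ssyt_def)

lemma sum_single: "finite A \<Longrightarrow> (\<Sum>x\<in>A. Poly_Mapping.single v (1::nat)) = Poly_Mapping.single v (card A)"
  by (induction A rule: finite_induct) (simp_all add: single_add[symmetric])

lemma ssyt_weight_extend_tab:
  assumes "hstrip \<kappa> p" "is_partition p"
  shows "ssyt_weight r p (extend_tab N p \<kappa> T) =
    Poly_Mapping.single (r, N) (part_size p - part_size \<kappa>) + ssyt_weight r \<kappa> T"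
proof -
  note \<kappa> = hstrip_partition[OF assms]
  have sub: "cells \<kappa> \<subseteq> cells p"
    using assms(1) by (auto simp: hstrip_def) (meson less_le_trans)
  have "ssyt_weight r p (extend_tab N p \<kappa> T) =
      (\<Sum>(i, j)\<in>cells p - cells \<kappa>. Poly_Mapping.single (r, extend_tab N p \<kappa> T i j) 1) +
      (\<Sum>(i, j)\<in>cells \<kappa>. Poly_Mapping.single (r, extend_tab N p \<kappa> T i j) 1)"
    unfolding ssyt_weight_def
    by (rule sum.subset_diff[OF sub finite_cells[OF assms(2)]])
  also have "(\<Sum>(i, j)\<in>cells p - cells \<kappa>. Poly_Mapping.single (r, extend_tab N p \<kappa> T i j) (1::nat)) =
      (\<Sum>x\<in>cells p - cells \<kappa>. Poly_Mapping.single (r, N) 1)"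
    by (rule sum.cong) (auto simp: extend_tab_def)
  also have "\<dots> = Poly_Mapping.single (r, N) (part_size p - part_size \<kappa>)"
    by (subst sum_single)
       (use sub finite_cells[OF assms(2)] finite_cells[OF \<kappa>]
         in \<open>auto simp: card_Diff_subset card_cells assms \<kappa>\<close>)
  also have "(\<Sum>(i, j)\<in>cells \<kappa>. Poly_Mapping.single (r, extend_tab N p \<kappa> T i j) 1) = ssyt_weight r \<kappa> T"
    unfolding ssyt_weight_def by (rule sum.cong) (auto simp: extend_tab_def)
  finally show ?thesis .
qed

text \<open>The cells with the largest letter fill the horizontal strip between
  \<open>\<kappa>\<close> and \<open>p\<close>; erasing them leaves an arbitrary tableau of shape
  \<open>\<kappa>\<close> in the remaining letters.\<close>

lemma schurN_Suc:
  assumes "is_partition p"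
  shows "schurN r (Suc N) p =
    (\<Sum>\<kappa> | hstrip \<kappa> p. mvar (r, N) ^ (part_size p - part_size \<kappa>) * schurN r N \<kappa>)"
proof -
  have weight: "ssyt_weight r p T = Poly_Mapping.single (r, N) (part_size p - part_size (small_shape N p T))
      + ssyt_weight r (small_shape N p T) (restrict_tab (small_shape N p T) T)"
    if "T \<in> tabs (Suc N) p" for T
    using ssyt_weight_extend_tab[OF hstrip_small_shape[OF that assms] assms, where N = N and r = r]
      extend_restrict_tab[OF that] by metis
  have "schurN r (Suc N) p = (\<Sum>(\<kappa>, T)\<in>(SIGMA \<kappa>:{\<kappa>. hstrip \<kappa> p}. tabs N \<kappa>).
      mvar (r, N) ^ (part_size p - part_size \<kappa>) * mmon (ssyt_weight r \<kappa> T))"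
    unfolding schurN_eq_sum[OF assms]
    by (rule sum.reindex_bij_witness[where
          i = "\<lambda>(\<kappa>, T). extend_tab N p \<kappa> T" and
          j = "\<lambda>T. (small_shape N p T, restrict_tab (small_shape N p T) T)"])
       (auto simp: extend_restrict_tab small_shape_extend_tab restrict_extend_tab
          extend_tab_in_tabs restrict_tab_in_tabs hstrip_small_shape assms
          mvar_power mmon_add[symmetric] weight[symmetric])
  also have "\<dots> = (\<Sum>\<kappa> | hstrip \<kappa> p. \<Sum>T\<in>tabs N \<kappa>.
      mvar (r, N) ^ (part_size p - part_size \<kappa>) * mmon (ssyt_weight r \<kappa> T))"
    by (rule sum.Sigma[symmetric])
       (auto simp: finite_hstrip_lower assms finite_tabs hstrip_partition)
  also have "\<dots> = (\<Sum>\<kappa> | hstrip \<kappa> p. mvar (r, N) ^ (part_size p - part_size \<kappa>) * schurN r N \<kappa>)"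
    by (rule sum.cong)
       (auto simp: schurN_eq_sum hstrip_partition[OF _ assms] sum_distrib_left)
  finally show ?thesis .
qed

lemma schurN_0:
  assumes "is_partition p"
  shows "schurN r 0 p = (if p = (\<lambda>_. 0) then 1 else 0)"
proof -
  have "tabs 0 p = (if p = (\<lambda>_. 0) then {\<lambda>_ _. 0} else {})"
    by (auto simp: tabs_def is_ssyt_def fun_eq_iff)
  moreover have "cells (\<lambda>_. 0) = {}"
    by (auto simp: cells_def)
  ultimately show ?thesis
    by (simp add: schurN_eq_sum assms ssyt_weight_def)
qed

section \<open>The Pieri rules\<close>

definition hfps :: "'m \<Rightarrow> nat \<Rightarrow> ('m \<times> nat, 'a::comm_ring_1) mfps fps" where
  "hfps r N = (\<Prod>k<N. Abs_fps (\<lambda>d. mvar (r, k) ^ d))"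

text \<open>The coefficient of z^k is (-1)^k e_k; with the sign included, this series is the inverse
  of \<open>hfps\<close>.\<close>

definition efps :: "'m \<Rightarrow> nat \<Rightarrow> ('m \<times> nat, 'a::comm_ring_1) mfps fps" where
  "efps r N = (\<Prod>k<N. 1 - fps_const (mvar (r, k)) * fps_X)"

lemma efps_hfps: "efps r N * hfps r N = 1"
proof -
  have "(1 - fps_const x * fps_X) * Abs_fps (\<lambda>d. x ^ d) = 1" for x :: "('a \<times> nat, 'b) mfps"
  proof (rule fps_ext)
    fix n
    show "fps_nth ((1 - fps_const x * fps_X) * Abs_fps (\<lambda>d. x ^ d)) n = fps_nth 1 n"
      by (cases n) (simp_all add: left_diff_distrib mult.assoc)
  qed
  thus ?thesis
    by (simp add: efps_def hfps_def prod.distrib[symmetric])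
qed

lemma hfps_Suc_nth:
  "fps_nth (hfps r (Suc N)) a = (\<Sum>j\<le>a. mvar (r, N) ^ j * fps_nth (hfps r N) (a - j))"
  by (simp add: hfps_def lessThan_Suc fps_mult_nth atMost_atLeast0)

text \<open>The local rule behind the commutation of adding and removing horizontal strips: the
  sizes of the rows of \<open>\<nu>\<close> (inside \<open>\<lambda>\<close> and \<open>\<kappa>\<close>) and of \<open>\<mu>\<close> (containing both) range over the same
  intervals, except that the first row of \<open>\<mu>\<close> is unbounded.\<close>

definition row_min :: "(nat \<Rightarrow> nat) \<Rightarrow> (nat \<Rightarrow> nat) \<Rightarrow> nat \<Rightarrow> nat" where
  "row_min p q i = min (p i) (q i)"

definition row_max :: "(nat \<Rightarrow> nat) \<Rightarrow> (nat \<Rightarrow> nat) \<Rightarrow> nat \<Rightarrow> nat" where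
  "row_max p q i = max (p i) (q i)"

text \<open>Entry \<open>i\<close> is the reflection of \<open>\<mu> (Suc i)\<close> in the interval
  from \<open>row_max p q (Suc i)\<close> to \<open>row_min p q i\<close>. Reflecting makes the sum
  of the two entries independent of \<open>\<mu>\<close>, which is what balances the sizes.\<close>

definition inner_shape :: "(nat \<Rightarrow> nat) \<Rightarrow> (nat \<Rightarrow> nat) \<Rightarrow> (nat \<Rightarrow> nat) \<Rightarrow> nat \<Rightarrow> nat" where
  "inner_shape p q \<mu> i = row_max p q (Suc i) + row_min p q i - \<mu> (Suc i)"

text \<open>The inverse reflection. The unbounded first row has no partner in \<open>\<nu>\<close>;
  its excess \<open>j\<close> will be the power of the new letter taken from h_a.\<close>

definition outer_shape ::
  "(nat \<Rightarrow> nat) \<Rightarrow> (nat \<Rightarrow> nat) \<Rightarrow> nat \<Rightarrow> (nat \<Rightarrow> nat) \<Rightarrow> nat \<Rightarrow> nat" where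
  "outer_shape p q j \<nu> i = (case i of 0 \<Rightarrow> row_max p q 0 + j
     | Suc i \<Rightarrow> row_max p q (Suc i) + row_min p q i - \<nu> i)"

lemma hstrip_inner_iff:
  "hstrip \<nu> p \<and> hstrip \<nu> q \<longleftrightarrow> (\<forall>i. row_max p q (Suc i) \<le> \<nu> i \<and> \<nu> i \<le> row_min p q i)"
  by (auto simp: hstrip_def row_min_def row_max_def)

lemma hstrip_outer_iff:
  "hstrip p \<mu> \<and> hstrip q \<mu> \<longleftrightarrow> row_max p q 0 \<le> \<mu> 0 \<and>
     (\<forall>i. row_max p q (Suc i) \<le> \<mu> (Suc i) \<and> \<mu> (Suc i) \<le> row_min p q i)"
proof -
  have split: "(\<forall>i. P i) \<longleftrightarrow> P 0 \<and> (\<forall>i. P (Suc i))" for P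
    by (metis not0_implies_Suc)
  have "hstrip p \<mu> \<and> hstrip q \<mu> \<longleftrightarrow> (\<forall>i. row_max p q i \<le> \<mu> i) \<and> (\<forall>i. \<mu> (Suc i) \<le> row_min p q i)"
    by (auto simp: hstrip_def row_min_def row_max_def)
  thus ?thesis
    by (subst (asm) split) blast
qed

lemma hstrip_outer_partition:
  assumes "hstrip p \<mu>" "is_partition p"
  shows "is_partition \<mu>"
proof -
  obtain L where L: "\<And>i. i \<ge> L \<Longrightarrow> p i = 0"
    using is_partition_bound[OF assms(2)] by blast
  have "\<mu> (Suc i) \<le> \<mu> i" for i
    using assms(1) unfolding hstrip_def by (meson order_trans)
  moreover have "\<mu> i = 0" if i: "i \<ge> Suc L" for i
  proof -
    obtain k where "i = Suc k" "k \<ge> L"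
      using i by (cases i) auto
    thus ?thesis
      using assms(1) L[of k] unfolding hstrip_def by (metis le_zero_eq)
  qed
  ultimately show ?thesis
    by (rule is_partitionI)
qed

lemma max_add_min: "max a b + min a b = a + (b::nat)"
  by simp

text \<open>After an index shift, pairing row \<open>Suc i\<close> of \<open>\<mu>\<close> with row
  \<open>i\<close> of \<open>\<nu>\<close> leaves max plus min of \<open>p i\<close> and
  \<open>q i\<close>, which is their sum.\<close>

lemma part_size_inner_outer:
  assumes "is_partition p" "is_partition q" "is_partition \<mu>" "is_partition \<nu>"
    and "\<mu> 0 = row_max p q 0 + j"
    and "\<And>i. \<mu> (Suc i) + \<nu> i = row_max p q (Suc i) + row_min p q i"
  shows "part_size \<mu> + part_size \<nu> = part_size p + part_size q + j"
proof -
  obtain Lp where Lp: "\<And>i. i \<ge> Lp \<Longrightarrow> p i = 0"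
    using is_partition_bound[OF assms(1)] by blast
  obtain Lq where Lq: "\<And>i. i \<ge> Lq \<Longrightarrow> q i = 0"
    using is_partition_bound[OF assms(2)] by blast
  obtain Lm where Lm: "\<And>i. i \<ge> Lm \<Longrightarrow> \<mu> i = 0"
    using is_partition_bound[OF assms(3)] by blast
  obtain Ln where Ln: "\<And>i. i \<ge> Ln \<Longrightarrow> \<nu> i = 0"
    using is_partition_bound[OF assms(4)] by blast
  define L where "L = Lp + Lq + Lm + Ln"
  have L: "p i = 0" "q i = 0" "\<mu> i = 0" "\<nu> i = 0" if "i \<ge> L" for i
    using that by (auto simp: L_def intro: Lp Lq Lm Ln)
  have "part_size \<mu> + part_size \<nu> = (\<Sum>i<Suc L. \<mu> i) + (\<Sum>i<L. \<nu> i)"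
    using part_size_eq_sum[of "Suc L" \<mu>] part_size_eq_sum[of L \<nu>] L by simp
  also have "\<dots> = \<mu> 0 + (\<Sum>i<L. \<mu> (Suc i) + \<nu> i)"
    unfolding sum.lessThan_Suc_shift sum.distrib by simp
  also have "\<dots> = j + (\<Sum>i<Suc L. row_max p q i) + (\<Sum>i<L. row_min p q i)"
    unfolding sum.lessThan_Suc_shift assms(5,6) sum.distrib by simp
  \<comment> \<open>The extra term \<open>i = L\<close> of the first sum vanishes by the choice of
    \<open>L\<close>.\<close>
  also have "\<dots> = j + (\<Sum>i<L. row_max p q i + row_min p q i)"
    by (simp add: row_max_def L sum.distrib)
  also have "\<dots> = j + (\<Sum>i<L. p i + q i)"
    by (simp only: row_max_def row_min_def max_add_min)
  also have "\<dots> = part_size p + part_size q + j"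
    using part_size_eq_sum[of L p] part_size_eq_sum[of L q] L by (simp add: sum.distrib)
  finally show ?thesis .
qed

text \<open>Removing a strip from \<open>p\<close> and then adding one is traded for adding a strip
  and then removing one. The last claim compares the exponents of the new letter on the two sides of
  the Pieri rule.\<close>

lemma outer_shape:
  assumes "is_partition p" "hstrip \<nu> p" "\<kappa> \<in> hstrips (a - j) \<nu>" "j \<le> a"
  defines "\<mu> \<equiv> outer_shape p \<kappa> j \<nu>"
  shows "\<mu> \<in> hstrips a p" "hstrip \<kappa> \<mu>" "inner_shape p \<kappa> \<mu> = \<nu>" "\<mu> 0 - row_max p \<kappa> 0 = j"
    "j + (part_size p - part_size \<nu>) = part_size \<mu> - part_size \<kappa>"
proof -
  have \<kappa>: "hstrip \<nu> \<kappa>" "is_partition \<kappa>" "part_size \<kappa> = part_size \<nu> + (a - j)"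
    using assms(3) by (auto simp: hstrips_def)
  have \<nu>: "row_max p \<kappa> (Suc i) \<le> \<nu> i" "\<nu> i \<le> row_min p \<kappa> i" for i
    using hstrip_inner_iff[of \<nu> p \<kappa>] assms(2) \<kappa> by auto
  have \<mu>0: "\<mu> 0 = row_max p \<kappa> 0 + j"
    and \<mu>S: "\<mu> (Suc i) = row_max p \<kappa> (Suc i) + row_min p \<kappa> i - \<nu> i" for i
    by (auto simp: \<mu>_def outer_shape_def)
  have "row_max p \<kappa> (Suc i) \<le> row_max p \<kappa> (Suc i) + row_min p \<kappa> i - \<nu> i \<and>
      row_max p \<kappa> (Suc i) + row_min p \<kappa> i - \<nu> i \<le> row_min p \<kappa> i" for i
    using \<nu>[of i] by linarith
  hence "hstrip p \<mu> \<and> hstrip \<kappa> \<mu>"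
    unfolding hstrip_outer_iff \<mu>0 \<mu>S by simp
  hence "hstrip p \<mu>" and h: "hstrip \<kappa> \<mu>"
    by auto
  show "hstrip \<kappa> \<mu>"
    by (rule h)
  note \<mu> = hstrip_outer_partition[OF \<open>hstrip p \<mu>\<close> assms(1)]
  have "\<nu> i \<le> row_max p \<kappa> (Suc i) + row_min p \<kappa> i" for i
    using \<nu>(2)[of i] by simp
  hence sum: "\<mu> (Suc i) + \<nu> i = row_max p \<kappa> (Suc i) + row_min p \<kappa> i" for i
    by (simp add: \<mu>S)
  have size: "part_size \<mu> + part_size \<nu> = part_size p + part_size \<kappa> + j"
    by (rule part_size_inner_outer[OF assms(1) \<kappa>(2) \<mu> hstrip_partition[OF assms(2,1)] \<mu>0 sum])
  have "part_size \<nu> \<le> part_size p"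
    by (rule part_size_mono) (use assms(1,2) in \<open>auto simp: hstrip_def\<close>)
  with size \<kappa>(3) assms(4) \<mu> \<open>hstrip p \<mu>\<close>
  show "\<mu> \<in> hstrips a p" "j + (part_size p - part_size \<nu>) = part_size \<mu> - part_size \<kappa>"
    by (auto simp: hstrips_def)
  show "inner_shape p \<kappa> \<mu> = \<nu>"
    by (rule ext) (simp add: inner_shape_def sum[symmetric])
  show "\<mu> 0 - row_max p \<kappa> 0 = j"
    by (simp add: \<mu>0)
qed

lemma inner_shape:
  assumes "is_partition p" "\<mu> \<in> hstrips a p" "hstrip \<kappa> \<mu>"
  defines "j \<equiv> \<mu> 0 - row_max p \<kappa> 0" and "\<nu> \<equiv> inner_shape p \<kappa> \<mu>"
  shows "j \<le> a" "hstrip \<nu> p" "\<kappa> \<in> hstrips (a - j) \<nu>" "outer_shape p \<kappa> j \<nu> = \<mu>"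
proof -
  have \<mu>: "hstrip p \<mu>" "is_partition \<mu>" "part_size \<mu> = part_size p + a"
    using assms(2) by (auto simp: hstrips_def)
  note \<kappa> = hstrip_partition[OF assms(3) \<mu>(2)]
  have \<mu>0: "\<mu> 0 = row_max p \<kappa> 0 + j"
    and \<mu>S: "row_max p \<kappa> (Suc i) \<le> \<mu> (Suc i)" "\<mu> (Suc i) \<le> row_min p \<kappa> i" for i
    using assms(3) \<mu>(1) unfolding j_def by (simp_all add: hstrip_outer_iff[of p \<mu> \<kappa>, THEN iffD1])
  have \<nu>_def': "\<nu> i = row_max p \<kappa> (Suc i) + row_min p \<kappa> i - \<mu> (Suc i)" for i
    by (simp add: \<nu>_def inner_shape_def)
  have "row_max p \<kappa> (Suc i) \<le> row_max p \<kappa> (Suc i) + row_min p \<kappa> i - \<mu> (Suc i) \<and>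
      row_max p \<kappa> (Suc i) + row_min p \<kappa> i - \<mu> (Suc i) \<le> row_min p \<kappa> i" for i
    using \<mu>S[of i] by linarith
  hence "hstrip \<nu> p \<and> hstrip \<nu> \<kappa>"
    unfolding hstrip_inner_iff \<nu>_def' by simp
  hence h: "hstrip \<nu> p" and "hstrip \<nu> \<kappa>"
    by auto
  show "hstrip \<nu> p"
    by (rule h)
  have "\<mu> (Suc i) \<le> row_max p \<kappa> (Suc i) + row_min p \<kappa> i" for i
    using \<mu>S(2)[of i] by simp
  hence sum: "\<mu> (Suc i) + \<nu> i = row_max p \<kappa> (Suc i) + row_min p \<kappa> i" for i
    by (simp add: \<nu>_def')
  have size: "part_size \<mu> + part_size \<nu> = part_size p + part_size \<kappa> + j"
    by (rule part_size_inner_outer[OF assms(1) \<kappa> \<mu>(2) hstrip_partition[OF h assms(1)] \<mu>0 sum])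
  \<comment> \<open>By \<open>size\<close>, \<open>a\<close> exceeds \<open>j\<close> by the
    difference of these two sizes, so this inequality bounds \<open>j\<close>.\<close>
  have "part_size \<nu> \<le> part_size \<kappa>"
    by (rule part_size_mono) (use \<kappa> \<open>hstrip \<nu> \<kappa>\<close> in \<open>auto simp: hstrip_def\<close>)
  with size \<mu>(3) show "j \<le> a"
    by simp
  with size \<mu>(3) \<kappa> \<open>hstrip \<nu> \<kappa>\<close> show "\<kappa> \<in> hstrips (a - j) \<nu>"
    by (auto simp: hstrips_def)
  show "outer_shape p \<kappa> j \<nu> = \<mu>"
  proof
    fix i
    show "outer_shape p \<kappa> j \<nu> i = \<mu> i"
      by (cases i) (simp_all add: outer_shape_def \<mu>0 sum[symmetric])
  qed
qed

lemma hstrips_0: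
  assumes "is_partition p"
  shows "hstrips 0 p = {p}"
proof -
  have "\<mu> = p" if "\<mu> \<in> hstrips 0 p" for \<mu>
  proof -
    have \<mu>: "is_partition \<mu>" "\<And>i. p i \<le> \<mu> i" "part_size \<mu> = part_size p"
      using that by (auto simp: hstrips_def hstrip_def)
    have "cells p \<subseteq> cells \<mu>"
      using \<mu>(2) by (auto simp: cells_def) (meson less_le_trans)
    hence "cells p = cells \<mu>"
      using \<mu> by (intro card_subset_eq) (auto simp: finite_cells card_cells assms)
    hence "j < p i \<longleftrightarrow> j < \<mu> i" for i j
      by (auto simp: cells_def set_eq_iff)
    thus ?thesis
      by (intro ext) (meson linorder_neq_iff)
  qed
  moreover have "p \<in> hstrips 0 p"
    using assms is_partitionD[OF assms] by (auto simp: hstrips_def hstrip_def)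
  ultimately show ?thesis
    by blast
qed

lemma schurN_h_pieri:
  assumes "is_partition p"
  shows "fps_nth (hfps r N) a * schurN r N p = (\<Sum>\<mu>\<in>hstrips a p. schurN r N \<mu>)"
  using assms
proof (induction N arbitrary: a p)
  case 0
  have "(\<Sum>\<mu>\<in>hstrips a p. schurN r 0 \<mu>) =
      (\<Sum>\<mu>\<in>hstrips a p. if \<mu> = (\<lambda>_. 0) then 1 else 0 :: ('a \<times> nat, 'b) mfps)"
    by (rule sum.cong) (auto simp: schurN_0 hstrips_def)
  also have "\<dots> = (if (\<lambda>_. 0) \<in> hstrips a p then 1 else 0)"
    by simp
  also have "(\<lambda>_. 0) \<in> hstrips a p \<longleftrightarrow> a = 0 \<and> p = (\<lambda>_. 0)"
    by (auto simp: hstrips_def hstrip_def is_partition_def antimono_def part_size_def)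
  finally show ?case
    using 0 by (simp add: schurN_0 hfps_def)
next
  case (Suc N a p)
  let ?x = "mvar (r, N) :: ('a \<times> nat, 'b) mfps"
  let ?A = "SIGMA j:{..a}. SIGMA \<nu>:{\<nu>. hstrip \<nu> p}. hstrips (a - j) \<nu>"
  let ?B = "SIGMA \<mu>:hstrips a p. {\<kappa>. hstrip \<kappa> \<mu>}"
  have part: "is_partition \<nu>" if "hstrip \<nu> p" for \<nu>
    using that Suc.prems by (rule hstrip_partition)
  have fin: "finite {\<kappa>. hstrip \<kappa> \<mu>}" if "\<mu> \<in> hstrips a p" for \<mu>
    using that by (intro finite_hstrip_lower) (auto simp: hstrips_def)
  \<comment> \<open>h_a is split by powers of the new letter and the Schur function by the branching
    rule; the remaining product involves only \<open>N\<close> letters.\<close>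
  have "fps_nth (hfps r (Suc N)) a * schurN r (Suc N) p =
      (\<Sum>j\<le>a. \<Sum>\<nu> | hstrip \<nu> p. ?x ^ j * ?x ^ (part_size p - part_size \<nu>) *
         (fps_nth (hfps r N) (a - j) * schurN r N \<nu>))"
    by (simp add: hfps_Suc_nth schurN_Suc Suc.prems sum_product mult_ac)
  also have "\<dots> = (\<Sum>j\<le>a. \<Sum>\<nu> | hstrip \<nu> p. \<Sum>\<kappa>\<in>hstrips (a - j) \<nu>.
      ?x ^ (j + (part_size p - part_size \<nu>)) * schurN r N \<kappa>)"
    by (intro sum.cong refl)
       (simp add: Suc.IH part sum_distrib_left power_add)
  also have "\<dots> = (\<Sum>j\<le>a. \<Sum>(\<nu>, \<kappa>)\<in>(SIGMA \<nu>:{\<nu>. hstrip \<nu> p}. hstrips (a - j) \<nu>).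
      ?x ^ (j + (part_size p - part_size \<nu>)) * schurN r N \<kappa>)"
    by (intro sum.cong refl sum.Sigma) (auto simp: finite_hstrip_lower Suc.prems)
  also have "\<dots> = (\<Sum>(j, \<nu>, \<kappa>)\<in>?A. ?x ^ (j + (part_size p - part_size \<nu>)) * schurN r N \<kappa>)"
    by (intro sum.Sigma) (auto simp: finite_hstrip_lower Suc.prems)
  \<comment> \<open>The exchange of strips keeps \<open>\<kappa>\<close> and trades
    \<open>(j, \<nu>)\<close> for \<open>\<mu>\<close>.\<close>
  also have "\<dots> = (\<Sum>(\<mu>, \<kappa>)\<in>?B. ?x ^ (part_size \<mu> - part_size \<kappa>) * schurN r N \<kappa>)"
    by (rule sum.reindex_bij_witness[where
          j = "\<lambda>(j, \<nu>, \<kappa>). (outer_shape p \<kappa> j \<nu>, \<kappa>)" and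
          i = "\<lambda>(\<mu>, \<kappa>). (\<mu> 0 - row_max p \<kappa> 0, inner_shape p \<kappa> \<mu>, \<kappa>)"])
       (use Suc.prems in \<open>auto simp: outer_shape inner_shape\<close>)
  also have "\<dots> = (\<Sum>\<mu>\<in>hstrips a p. \<Sum>\<kappa> | hstrip \<kappa> \<mu>. ?x ^ (part_size \<mu> - part_size \<kappa>) * schurN r N \<kappa>)"
    by (rule sum.Sigma[symmetric]) (auto simp: fin)
  also have "\<dots> = (\<Sum>\<mu>\<in>hstrips a p. schurN r (Suc N) \<mu>)"
    by (rule sum.cong) (auto simp: schurN_Suc hstrips_def)
  finally show ?case .
qed

section \<open>Vertical strips and the Pieri rule for elementary symmetric functions\<close>

lemma part_size_upd:
  assumes "is_partition p"
  shows "part_size (p(i := x)) + p i = part_size p + x"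
proof -
  obtain L where L: "\<And>i. i \<ge> L \<Longrightarrow> p i = 0"
    using is_partition_bound[OF assms] by blast
  define M where "M = L + Suc i"
  have "part_size (p(i := x)) = (\<Sum>k<M. (p(i := x)) k)" "part_size p = (\<Sum>k<M. p k)"
    by (rule part_size_eq_sum; use L in \<open>force simp: M_def\<close>)+
  moreover have "i \<in> {..<M}"
    by (simp add: M_def)
  hence "(\<Sum>k<M. (p(i := x)) k) = x + (\<Sum>k\<in>{..<M} - {i}. p k)"
    "(\<Sum>k<M. p k) = p i + (\<Sum>k\<in>{..<M} - {i}. p k)"
    by (subst sum.remove[of _ i]; simp)+
  ultimately show ?thesis
    by simp
qed

text \<open>For fixed \<open>p\<close> and \<open>\<nu>\<close>, the conditions on a shape \<open>\<kappa>\<close> such that \<open>\<kappa>/p\<close> is a horizontal and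
  \<open>\<nu>/\<kappa>\<close> a vertical strip concern each row separately. In the first row where \<open>p\<close> and \<open>\<nu>\<close> differ,
  both \<open>\<nu> i\<close> and \<open>\<nu> i - 1\<close> are allowed, and toggling between them reverses the sign.\<close>

definition hv_strips :: "nat \<Rightarrow> (nat \<Rightarrow> nat) \<Rightarrow> ((nat \<Rightarrow> nat) \<times> (nat \<Rightarrow> nat)) set" where
  "hv_strips k p = {(\<kappa>, \<nu>). is_partition \<nu> \<and> hstrip p \<kappa> \<and> vstrip \<kappa> \<nu> \<and> part_size \<nu> = part_size p + k}"

text \<open>It depends on \<open>\<nu>\<close> but not on \<open>\<kappa>\<close>, so changing
  \<open>\<kappa>\<close> in this row does not move the row. That makes the toggle an
  involution.\<close>

definition first_diff :: "(nat \<Rightarrow> nat) \<Rightarrow> (nat \<Rightarrow> nat) \<Rightarrow> nat" where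
  "first_diff p \<nu> = (LEAST i. \<nu> i \<noteq> p i)"

lemma first_diff:
  assumes "(\<kappa>, \<nu>) \<in> hv_strips k p" "k > 0"
  shows "p (first_diff p \<nu>) < \<nu> (first_diff p \<nu>)" "\<And>i. i < first_diff p \<nu> \<Longrightarrow> \<nu> i = p i"
proof -
  have "\<nu> \<noteq> p"
    using assms by (auto simp: hv_strips_def)
  hence "\<exists>i. \<nu> i \<noteq> p i"
    by auto
  hence "\<nu> (first_diff p \<nu>) \<noteq> p (first_diff p \<nu>)"
    unfolding first_diff_def by (rule LeastI_ex)
  moreover have "p i \<le> \<nu> i" for i
    using assms by (auto simp: hv_strips_def hstrip_def vstrip_def intro: order_trans)
  ultimately show "p (first_diff p \<nu>) < \<nu> (first_diff p \<nu>)"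
    by (metis order_le_imp_less_or_eq)
  show "\<nu> i = p i" if "i < first_diff p \<nu>" for i
    using not_less_Least[OF that[unfolded first_diff_def]] by simp
qed

text \<open>In row \<open>i\<close> the value \<open>\<nu> i\<close> exceeds \<open>p i\<close>, so
  \<open>x\<close> is still at least \<open>p i\<close>. The rows above \<open>i\<close> agree, so
  \<open>x\<close> is at most the preceding row of \<open>\<nu>\<close>, which is that of
  \<open>p\<close>, and the strip stays horizontal.\<close>

lemma hv_strips_upd:
  assumes "(\<kappa>, \<nu>) \<in> hv_strips k p" "k > 0"
    and "i = first_diff p \<nu>" "x \<le> \<nu> i" "\<nu> i \<le> Suc x"
  shows "(\<kappa>(i := x), \<nu>) \<in> hv_strips k p"
proof -
  have \<nu>: "is_partition \<nu>"
    and h: "\<And>j. p j \<le> \<kappa> j" "\<And>j. \<kappa> (Suc j) \<le> p j" and v: "\<And>j. \<kappa> j \<le> \<nu> j" "\<And>j. \<nu> j \<le> Suc (\<kappa> j)"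
    and size: "part_size \<nu> = part_size p + k"
    using assms(1) by (auto simp: hv_strips_def hstrip_def vstrip_def)
  note diff = first_diff[OF assms(1,2), folded assms(3)]
  have "x \<le> p j" if "i = Suc j" for j
    using diff(2)[of j] is_partitionD[OF \<nu>, of j i] that assms(4) by simp
  hence "hstrip p (\<kappa>(i := x))"
    using h diff(1) assms(5) by (auto simp: hstrip_def)
  moreover have "vstrip (\<kappa>(i := x)) \<nu>"
    using v assms(4,5) by (auto simp: vstrip_def)
  ultimately show ?thesis
    using \<nu> size by (simp add: hv_strips_def)
qed

lemma finite_hv_strips:
  assumes "is_partition p"
  shows "finite (hv_strips k p)"
proof (rule finite_subset)
  let ?P = "{\<nu>. is_partition \<nu> \<and> part_size \<nu> \<le> part_size p + k}"
  show "hv_strips k p \<subseteq> ?P \<times> ?P"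
  proof clarify
    fix \<kappa> \<nu>
    assume hv: "(\<kappa>, \<nu>) \<in> hv_strips k p"
    hence "is_partition \<kappa>"
      using hstrip_outer_partition[OF _ assms] by (auto simp: hv_strips_def)
    moreover have "part_size \<kappa> \<le> part_size \<nu>"
      by (rule part_size_mono) (use hv in \<open>auto simp: hv_strips_def vstrip_def\<close>)
    ultimately show "\<kappa> \<in> ?P \<and> \<nu> \<in> ?P"
      using hv by (simp add: hv_strips_def)
  qed
  show "finite (?P \<times> ?P)"
    by (intro finite_cartesian_product finite_partitions)
qed

lemma hv_strips_alternating:
  fixes f :: "(nat \<Rightarrow> nat) \<Rightarrow> 'a::comm_ring_1"
  assumes "is_partition p" "k > 0"
  shows "(\<Sum>(\<kappa>, \<nu>)\<in>hv_strips k p. (-1) ^ (part_size \<nu> - part_size \<kappa>) * f \<nu>) = 0"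
proof -
  let ?g = "\<lambda>(\<kappa>, \<nu>). (-1) ^ (part_size \<nu> - part_size \<kappa>) * f \<nu>"
  define A where "A = {(\<kappa>, \<nu>) \<in> hv_strips k p. \<kappa> (first_diff p \<nu>) = \<nu> (first_diff p \<nu>)}"
  define B where "B = {(\<kappa>, \<nu>) \<in> hv_strips k p. Suc (\<kappa> (first_diff p \<nu>)) = \<nu> (first_diff p \<nu>)}"
  \<comment> \<open>A vertical strip leaves only these options in a row, so \<open>A\<close> and
    \<open>B\<close> exhaust all pairs.\<close>
  have "\<kappa> i = \<nu> i \<or> Suc (\<kappa> i) = \<nu> i" if "(\<kappa>, \<nu>) \<in> hv_strips k p" for \<kappa> \<nu> i
  proof -
    have "\<kappa> i \<le> \<nu> i" "\<nu> i \<le> Suc (\<kappa> i)"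
      using that by (auto simp: hv_strips_def vstrip_def)
    thus ?thesis
      by linarith
  qed
  hence AB: "hv_strips k p = A \<union> B"
    by (auto simp: A_def B_def)
  define dn where "dn \<kappa> \<nu> = \<kappa>(first_diff p \<nu> := \<nu> (first_diff p \<nu>) - 1)" for \<kappa> \<nu> :: "nat \<Rightarrow> nat"
  define up where "up \<kappa> \<nu> = \<kappa>(first_diff p \<nu> := \<nu> (first_diff p \<nu>))" for \<kappa> \<nu> :: "nat \<Rightarrow> nat"
  have dn: "up (dn \<kappa> \<nu>) \<nu> = \<kappa>" "(dn \<kappa> \<nu>, \<nu>) \<in> B"
    "(-1) ^ (part_size \<nu> - part_size (dn \<kappa> \<nu>)) = - ((-1) ^ (part_size \<nu> - part_size \<kappa>) :: 'a)"
    if "(\<kappa>, \<nu>) \<in> A" for \<kappa> \<nu>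
  proof -
    define i where "i = first_diff p \<nu>"
    have hv: "(\<kappa>, \<nu>) \<in> hv_strips k p" and eq: "\<kappa> i = \<nu> i"
      using that by (auto simp: A_def i_def)
    have pos: "\<nu> i > 0"
      using first_diff(1)[OF hv assms(2)] by (simp add: i_def)
    show "up (dn \<kappa> \<nu>) \<nu> = \<kappa>"
      using eq by (auto simp: i_def dn_def up_def)
    show "(dn \<kappa> \<nu>, \<nu>) \<in> B"
      using hv_strips_upd[OF hv assms(2) i_def, of "\<nu> i - 1"] pos by (auto simp: B_def i_def dn_def)
    have \<kappa>: "is_partition \<kappa>"
      using hv hstrip_outer_partition[OF _ assms(1)] by (auto simp: hv_strips_def)
    have "part_size \<kappa> \<le> part_size \<nu>"
      by (rule part_size_mono) (use hv in \<open>auto simp: hv_strips_def vstrip_def\<close>)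
    moreover have "part_size (dn \<kappa> \<nu>) + \<kappa> i = part_size \<kappa> + (\<nu> i - 1)"
      unfolding dn_def i_def by (rule part_size_upd[OF \<kappa>])
    hence "part_size \<kappa> = Suc (part_size (dn \<kappa> \<nu>))"
      using eq pos by simp
    ultimately have "part_size \<nu> - part_size (dn \<kappa> \<nu>) = Suc (part_size \<nu> - part_size \<kappa>)"
      by simp
    thus "(-1) ^ (part_size \<nu> - part_size (dn \<kappa> \<nu>)) = - ((-1) ^ (part_size \<nu> - part_size \<kappa>) :: 'a)"
      by simp
  qed
  have up: "dn (up \<kappa> \<nu>) \<nu> = \<kappa>" "(up \<kappa> \<nu>, \<nu>) \<in> A" if "(\<kappa>, \<nu>) \<in> B" for \<kappa> \<nu>
  proof -
    define i where "i = first_diff p \<nu>"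
    have hv: "(\<kappa>, \<nu>) \<in> hv_strips k p" and eq: "Suc (\<kappa> i) = \<nu> i"
      using that by (auto simp: B_def i_def)
    show "dn (up \<kappa> \<nu>) \<nu> = \<kappa>"
      using eq[symmetric] by (auto simp: i_def dn_def up_def)
    show "(up \<kappa> \<nu>, \<nu>) \<in> A"
      using hv_strips_upd[OF hv assms(2) i_def, of "\<nu> i"] by (auto simp: A_def i_def up_def)
  qed
  have "finite (A \<union> B)"
    using finite_hv_strips[OF assms(1), of k] by (simp only: AB)
  moreover have "A \<inter> B = {}"
    by (auto simp: A_def B_def)
  ultimately have "finite A" "finite B" "A \<inter> B = {}"
    by simp_all
  hence "sum ?g (hv_strips k p) = sum ?g A + sum ?g B"
    by (simp add: AB sum.union_disjoint)
  also have "sum ?g A = (\<Sum>x\<in>B. - ?g x)"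
    by (rule sum.reindex_bij_witness[where j = "\<lambda>(\<kappa>, \<nu>). (dn \<kappa> \<nu>, \<nu>)" and
          i = "\<lambda>(\<kappa>, \<nu>). (up \<kappa> \<nu>, \<nu>)"])
       (auto simp: dn up)
  also have "(\<Sum>x\<in>B. - ?g x) + sum ?g B = 0"
    by (simp add: sum_negf)
  finally show ?thesis .
qed

text \<open>The combinatorial counterpart of sum_j (-1)^j e_j h_{k-j} = 0. Since \<open>j\<close> is
  the difference of the sizes of \<open>\<nu>\<close> and \<open>\<kappa>\<close>, the triple sum
  runs over the pairs in \<open>hv_strips\<close>.\<close>

lemma strips_alternating:
  fixes f :: "(nat \<Rightarrow> nat) \<Rightarrow> 'a::comm_ring_1"
  assumes "is_partition p" "k > 0"
  shows "(\<Sum>j\<le>k. (-1) ^ j * (\<Sum>\<kappa>\<in>hstrips (k - j) p. \<Sum>\<nu>\<in>vstrips j \<kappa>. f \<nu>)) = 0"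
proof -
  let ?A = "SIGMA j:{..k}. SIGMA \<kappa>:hstrips (k - j) p. vstrips j \<kappa>"
  have in_hv: "(\<kappa>, \<nu>) \<in> hv_strips k p" "part_size \<nu> - part_size \<kappa> = j"
    if "j \<le> k" "\<kappa> \<in> hstrips (k - j) p" "\<nu> \<in> vstrips j \<kappa>" for j \<kappa> \<nu>
    using that by (auto simp: hstrips_def vstrips_def hv_strips_def)
  have from_hv: "part_size \<nu> - part_size \<kappa> \<le> k"
    "\<kappa> \<in> hstrips (k - (part_size \<nu> - part_size \<kappa>)) p" "\<nu> \<in> vstrips (part_size \<nu> - part_size \<kappa>) \<kappa>"
    if "(\<kappa>, \<nu>) \<in> hv_strips k p" for \<kappa> \<nu>
  proof -
    have hv: "is_partition \<nu>" "hstrip p \<kappa>" "vstrip \<kappa> \<nu>" "part_size \<nu> = part_size p + k"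
      using that by (auto simp: hv_strips_def)
    note \<kappa> = hstrip_outer_partition[OF hv(2) assms(1)]
    have "part_size \<kappa> \<le> part_size \<nu>"
      by (rule part_size_mono) (use hv in \<open>auto simp: vstrip_def\<close>)
    moreover have "part_size p \<le> part_size \<kappa>"
      by (rule part_size_mono) (use hv \<kappa> in \<open>auto simp: hstrip_def\<close>)
    ultimately show "part_size \<nu> - part_size \<kappa> \<le> k"
      "\<kappa> \<in> hstrips (k - (part_size \<nu> - part_size \<kappa>)) p" "\<nu> \<in> vstrips (part_size \<nu> - part_size \<kappa>) \<kappa>"
      using hv \<kappa> by (auto simp: hstrips_def vstrips_def)
  qed
  have "(\<Sum>j\<le>k. (-1) ^ j * (\<Sum>\<kappa>\<in>hstrips (k - j) p. \<Sum>\<nu>\<in>vstrips j \<kappa>. f \<nu>)) =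
      (\<Sum>j\<le>k. \<Sum>\<kappa>\<in>hstrips (k - j) p. \<Sum>\<nu>\<in>vstrips j \<kappa>. (-1) ^ j * f \<nu>)"
    by (simp add: sum_distrib_left)
  also have "\<dots> = (\<Sum>j\<le>k. \<Sum>(\<kappa>, \<nu>)\<in>(SIGMA \<kappa>:hstrips (k - j) p. vstrips j \<kappa>). (-1) ^ j * f \<nu>)"
    by (intro sum.cong refl sum.Sigma) auto
  also have "\<dots> = (\<Sum>(j, \<kappa>, \<nu>)\<in>?A. (-1) ^ j * f \<nu>)"
    by (intro sum.Sigma) auto
  also have "\<dots> = (\<Sum>(\<kappa>, \<nu>)\<in>hv_strips k p. (-1) ^ (part_size \<nu> - part_size \<kappa>) * f \<nu>)"
    by (rule sum.reindex_bij_witness[where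
          j = "\<lambda>(j, \<kappa>, \<nu>). (\<kappa>, \<nu>)" and i = "\<lambda>(\<kappa>, \<nu>). (part_size \<nu> - part_size \<kappa>, \<kappa>, \<nu>)"])
       (use in_hv from_hv in auto)
  also have "\<dots> = 0"
    by (rule hv_strips_alternating[OF assms])
  finally show ?thesis .
qed

lemma vstrips_0:
  assumes "is_partition p"
  shows "vstrips 0 p = {p}"
proof -
  have "bij_betw part_conj (vstrips 0 p) {part_conj p}"
    using bij_betw_conj_vstrips[OF assms, of 0]
    by (simp add: hstrips_0 is_partition_conj assms)
  moreover have "p \<in> vstrips 0 p"
    using assms by (simp add: vstrips_def vstrip_def)
  ultimately show ?thesis
    by (auto simp: bij_betw_def inj_on_def)
qed

lemma hfps_nth_0 [simp]: "fps_nth (hfps r N) 0 = 1"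
  by (induction N) (simp_all add: hfps_def lessThan_Suc)

lemma efps_nth_0 [simp]: "fps_nth (efps r N) 0 = 1"
  by (induction N) (simp_all add: efps_def lessThan_Suc)

text \<open>The alternating sum of e_j h_{k-j}, applied to the Schur function, vanishes, and so does
  the corresponding sum over strips. By induction the two agree term by term for j < k, hence also
  in the last term, where h_0 = 1.\<close>

lemma schurN_e_pieri:
  fixes r :: 'm
  assumes "is_partition p"
  shows "fps_nth (efps r N) k * schurN r N p = (-1) ^ k * (\<Sum>\<nu>\<in>vstrips k p. schurN r N \<nu> :: ('m \<times> nat, 'a::comm_ring_1) mfps)"
  using assms
proof (induction k arbitrary: p rule: less_induct)
  case (less k)
  let ?e = "fps_nth (efps r N :: ('m \<times> nat, 'a) mfps fps)" and ?h = "fps_nth (hfps r N)"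
    and ?s = "schurN r N"
  show ?case
  proof (cases "k = 0")
    case True
    with less.prems show ?thesis
      by (simp add: vstrips_0)
  next
    case False
    have "(\<Sum>j\<le>k. ?e j * ?h (k - j)) = fps_nth (efps r N * hfps r N) k"
      by (simp add: fps_mult_nth atMost_atLeast0)
    also have "\<dots> = 0"
      using False by (simp add: efps_hfps)
    finally have "0 = (\<Sum>j\<le>k. ?e j * (?h (k - j) * ?s p))"
      by (metis (no_types, lifting) mult.assoc mult_zero_left sum.cong sum_distrib_right)
    also have "\<dots> = (\<Sum>j<k. ?e j * (?h (k - j) * ?s p)) + ?e k * ?s p"
      by (simp add: lessThan_Suc_atMost[symmetric])
    \<comment> \<open>The complete function acts first, so the induction hypothesis is applied to
      the enlarged shapes \<open>\<kappa>\<close>; this is why \<open>p\<close> is arbitrary in the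
      induction.\<close>
    also have "(\<Sum>j<k. ?e j * (?h (k - j) * ?s p)) =
        (\<Sum>j<k. (-1) ^ j * (\<Sum>\<kappa>\<in>hstrips (k - j) p. \<Sum>\<nu>\<in>vstrips j \<kappa>. ?s \<nu>))"
      unfolding schurN_h_pieri[OF less.prems] sum_distrib_left
      using less.IH by (intro sum.cong refl) (auto simp: hstrips_def sum_distrib_left)
    also have "\<dots> = - ((-1) ^ k * (\<Sum>\<nu>\<in>vstrips k p. ?s \<nu>))"
      using strips_alternating[OF less.prems, of k ?s] False
      by (simp add: lessThan_Suc_atMost[symmetric] hstrips_0 less.prems eq_neg_iff_add_eq_0)
    finally show ?thesis
      by simp
  qed
qed

section \<open>The functions \<open>q\<^sub>a\<close> and their action on Schur functions\<close>

text \<open>Scaling every \<open>x k\<close> by \<open>c\<close> amounts to substituting cz for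
  z.\<close>

lemma fps_prod_scaled_nth:
  "fps_nth (\<Prod>k<N. 1 - fps_const (c * x k) * fps_X) n =
     c ^ n * fps_nth (\<Prod>k<N. 1 - fps_const (x k) * fps_X) n"
  for c :: "'a::comm_ring_1" and N :: nat
proof (induction N arbitrary: n)
  case (Suc N)
  have step: "fps_nth (F * (1 - fps_const y * fps_X)) n =
      fps_nth F n - (if n = 0 then 0 else y * fps_nth F (n - 1))" for F :: "'a fps" and y
    by (simp add: right_diff_distrib mult.assoc[symmetric] mult.commute[of F "fps_const y"])
  show ?case
    unfolding prod.lessThan_Suc step Suc.IH
    by (cases n) (simp_all add: algebra_simps)
qed simp

lemma hl_gen_nth:
  "fps_nth (hl_gen r t N) a =
     (\<Sum>k\<le>a. mconst (t ^ k) * fps_nth (efps r N) k * fps_nth (hfps r N) (a - k))"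
  by (simp add: hl_gen_def prod.distrib fps_mult_nth fps_prod_scaled_nth efps_def hfps_def
        atMost_atLeast0 mconst_power)

lemma hl_factor_nth:
  "fps_nth ((1 - fps_const (mconst t * x) * fps_X) * Abs_fps (\<lambda>d. x ^ d)) n =
     (if n = 0 then 1 else mconst (1 - t) * x ^ n)"
  by (cases n) (simp_all add: left_diff_distrib mult.assoc mconst_diff)

text \<open>A letter set to zero contributes the factor 1, so the restriction cuts the product off
  at \<open>N\<close>.\<close>

lemma mrestr_hl_gen:
  fixes r :: 'm
  shows "mrestr (letters N) (fps_nth (hl_gen r t M) a) = fps_nth (hl_gen r t (min M N)) a"
proof (induction M arbitrary: a)
  case 0
  show ?case
    by (simp add: hl_gen_def fps_one_nth)
next
  case (Suc M)
  define f where
    "f = (1 - fps_const (mconst t * mvar (r, M)) * fps_X) * Abs_fps (\<lambda>d. mvar (r, M) ^ d)"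
  have f: "mrestr (letters N) (fps_nth f n) = fps_nth (if M < N then f else 1) n" for n
    by (simp add: f_def hl_factor_nth mrestr_mconst_mult mrestr_power mrestr_mvar fps_one_nth power_0_left)
  have Suc_M: "hl_gen r t (Suc M) = hl_gen r t M * f"
    by (simp add: hl_gen_def f_def lessThan_Suc mult.commute)
  have "mrestr (letters N) (fps_nth (hl_gen r t (Suc M)) a) =
      fps_nth (hl_gen r t (min M N) * (if M < N then f else 1)) a"
    unfolding Suc_M fps_mult_nth mrestr_sum mrestr_mult Suc.IH f ..
  also have "hl_gen r t (min M N) * (if M < N then f else 1) = hl_gen r t (min (Suc M) N)"
    using Suc_M by (cases "M < N") (simp_all add: min_def)
  finally show ?case .
qed

text \<open>The coefficient of a monomial in the first \<open>N\<close> letters is constant from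
  stage \<open>N\<close> on; this meets the definite description in \<open>hl_q\<close>.\<close>

lemma mrestr_hl_q:
  fixes r :: 'm
  shows "mrestr (letters N) (hl_q r t a) = (fps_nth (hl_gen r t N) a :: ('m \<times> nat, 'a::comm_ring_1) mfps)"
proof (rule mfps_eqI)
  fix e
  let ?c = "mcoeff (fps_nth (hl_gen r t N) a) e"
  let ?S = "\<forall>v. v \<notin> letters N \<longrightarrow> Poly_Mapping.lookup e v = 0"
  have fix_N: "mrestr (letters N) (fps_nth (hl_gen r t N) a) = fps_nth (hl_gen r t N) a"
    by (simp add: mrestr_hl_gen)
  show "mcoeff (mrestr (letters N) (hl_q r t a)) e = ?c"
  proof (cases ?S)
    case True
    have restr: "mcoeff (mrestr (letters N) F) e = mcoeff F e" for F :: "('m \<times> nat, 'a) mfps"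
      by (simp only: mcoeff_mrestr if_P[OF True])
    have "mcoeff (fps_nth (hl_gen r t M) a) e = ?c" if "M \<ge> N" for M
      using that restr[of "fps_nth (hl_gen r t M) a"] by (simp add: mrestr_hl_gen min_absorb2)
    hence ev: "\<forall>\<^sub>F M in sequentially. mcoeff (fps_nth (hl_gen r t M) a) e = ?c"
      by (rule eventually_sequentiallyI)
    have "(THE c. \<forall>\<^sub>F M in sequentially. mcoeff (fps_nth (hl_gen r t M) a) e = c) = ?c"
    proof (rule the_equality, rule ev)
      fix c
      assume "\<forall>\<^sub>F M in sequentially. mcoeff (fps_nth (hl_gen r t M) a) e = c"
      with ev have "\<forall>\<^sub>F M in sequentially. c = ?c"
        by eventually_elim simp
      thus "c = ?c"
        by simp
    qed
    thus ?thesis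
      unfolding restr by (simp add: hl_q_def)
  next
    case False
    have "mcoeff (mrestr (letters N) F) e = 0" for F :: "('m \<times> nat, 'a) mfps"
      by (simp only: mcoeff_mrestr if_not_P[OF False])
    thus ?thesis
      by (metis fix_N)
  qed
qed

lemma mconst_minus_power: "mconst ((- t) ^ k) = mconst (t ^ k) * (-1) ^ k"
  by (simp add: mconst_power mconst_uminus power_minus[of "mconst t"] mult.commute)

lemma hl_q_schur_hv:
  fixes r :: 'm
  assumes "is_partition p"
  shows "hl_q r t a * schur r p =
    (\<Sum>k\<le>a. mconst ((-t) ^ k) * (\<Sum>\<kappa>\<in>hstrips (a - k) p. \<Sum>\<nu>\<in>vstrips k \<kappa>. schur r \<nu>))"
proof (rule mfps_eq_mrestrI)
  fix N
  have "mrestr (letters N) (hl_q r t a * schur r p) =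
      (\<Sum>k\<le>a. mconst (t ^ k) * (fps_nth (efps r N) k * (fps_nth (hfps r N) (a - k) * schurN r N p)))"
    by (simp add: mrestr_mult mrestr_hl_q hl_gen_nth schurN_def sum_distrib_right mult.assoc)
  also have "\<dots> = (\<Sum>k\<le>a. mconst ((-t) ^ k) *
      (\<Sum>\<kappa>\<in>hstrips (a - k) p. \<Sum>\<nu>\<in>vstrips k \<kappa>. schurN r N \<nu>))"
  proof (rule sum.cong[OF refl])
    fix k
    have "fps_nth (efps r N) k * (fps_nth (hfps r N) (a - k) * schurN r N p) =
        (-1) ^ k * (\<Sum>\<kappa>\<in>hstrips (a - k) p. \<Sum>\<nu>\<in>vstrips k \<kappa>. schurN r N \<nu> :: ('m \<times> nat, 'a) mfps)"
      unfolding schurN_h_pieri[OF assms] sum_distrib_left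
      by (rule sum.cong) (auto simp: schurN_e_pieri hstrips_def sum_distrib_left)
    thus "mconst (t ^ k) * (fps_nth (efps r N) k * (fps_nth (hfps r N) (a - k) * schurN r N p)) =
        mconst ((-t) ^ k) * (\<Sum>\<kappa>\<in>hstrips (a - k) p. \<Sum>\<nu>\<in>vstrips k \<kappa>. schurN r N \<nu>)"
      by (simp add: mconst_minus_power mult.assoc)
  qed
  also have "\<dots> = mrestr (letters N) (\<Sum>k\<le>a. mconst ((-t) ^ k) *
      (\<Sum>\<kappa>\<in>hstrips (a - k) p. \<Sum>\<nu>\<in>vstrips k \<kappa>. schur r \<nu>))"
    by (simp add: mrestr_sum mrestr_mconst_mult schurN_def)
  finally show "mrestr (letters N) (hl_q r t a * schur r p) = \<dots>" .
qed

text \<open>The elementary factor now acts first, in the order that conjugation produces from the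
  previous expansion.\<close>

lemma hl_q_schur_vh:
  fixes r :: 'm
  assumes "is_partition p"
  shows "hl_q r t a * schur r p =
    (\<Sum>k\<le>a. mconst ((-t) ^ k) * (\<Sum>\<kappa>\<in>vstrips k p. \<Sum>\<nu>\<in>hstrips (a - k) \<kappa>. schur r \<nu>))"
proof (rule mfps_eq_mrestrI)
  fix N
  have "mrestr (letters N) (hl_q r t a * schur r p) =
      (\<Sum>k\<le>a. mconst (t ^ k) * (fps_nth (hfps r N) (a - k) * (fps_nth (efps r N) k * schurN r N p)))"
    by (simp add: mrestr_mult mrestr_hl_q hl_gen_nth schurN_def sum_distrib_left mult_ac)
  also have "\<dots> = (\<Sum>k\<le>a. mconst ((-t) ^ k) *
      (\<Sum>\<kappa>\<in>vstrips k p. \<Sum>\<nu>\<in>hstrips (a - k) \<kappa>. schurN r N \<nu>))"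
  proof (rule sum.cong[OF refl])
    fix k
    have "fps_nth (hfps r N) (a - k) * (fps_nth (efps r N) k * schurN r N p) =
        (-1) ^ k * (\<Sum>\<kappa>\<in>vstrips k p. fps_nth (hfps r N) (a - k) * schurN r N \<kappa> :: ('m \<times> nat, 'a) mfps)"
      unfolding schurN_e_pieri[OF assms] by (simp add: sum_distrib_left mult_ac)
    also have "(\<Sum>\<kappa>\<in>vstrips k p. fps_nth (hfps r N) (a - k) * schurN r N \<kappa> :: ('m \<times> nat, 'a) mfps) =
        (\<Sum>\<kappa>\<in>vstrips k p. \<Sum>\<nu>\<in>hstrips (a - k) \<kappa>. schurN r N \<nu>)"
      by (rule sum.cong) (auto simp: schurN_h_pieri vstrips_def)
    finally have "fps_nth (hfps r N) (a - k) * (fps_nth (efps r N) k * schurN r N p) =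
        (-1) ^ k * (\<Sum>\<kappa>\<in>vstrips k p. \<Sum>\<nu>\<in>hstrips (a - k) \<kappa>. schurN r N \<nu> :: ('m \<times> nat, 'a) mfps)" .
    thus "mconst (t ^ k) * (fps_nth (hfps r N) (a - k) * (fps_nth (efps r N) k * schurN r N p)) =
        mconst ((-t) ^ k) * (\<Sum>\<kappa>\<in>vstrips k p. \<Sum>\<nu>\<in>hstrips (a - k) \<kappa>. schurN r N \<nu>)"
      by (simp add: mconst_minus_power mult.assoc)
  qed
  also have "\<dots> = mrestr (letters N) (\<Sum>k\<le>a. mconst ((-t) ^ k) *
      (\<Sum>\<kappa>\<in>vstrips k p. \<Sum>\<nu>\<in>hstrips (a - k) \<kappa>. schur r \<nu>))"
    by (simp add: mrestr_sum mrestr_mconst_mult schurN_def)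
  finally show "mrestr (letters N) (hl_q r t a * schur r p) = \<dots>" .
qed

text \<open>Conjugation exchanges the two kinds of strips; this is the effect of the involution
  \<open>\<omega>\<close> on \<open>q\<^sub>a\<close>.\<close>

lemma hl_q_schur_conj:
  fixes r :: 'm and t :: "'a::field"
  assumes "is_partition p" "t \<noteq> 0"
  shows "mconst ((-t) ^ a) * hl_q r (inverse t) a * schur r (part_conj p) =
    (\<Sum>k\<le>a. mconst ((-t) ^ k) * (\<Sum>\<kappa>\<in>hstrips (a - k) p. \<Sum>\<nu>\<in>vstrips k \<kappa>. schur r (part_conj \<nu>)))"
proof -
  let ?p = "part_conj p"
  have inner: "(\<Sum>\<nu>\<in>hstrips k (part_conj \<kappa>). schur r \<nu>) =
      (\<Sum>\<nu>\<in>vstrips k \<kappa>. schur r (part_conj \<nu>) :: ('m \<times> nat, 'a) mfps)"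
    if "\<kappa> \<in> hstrips b p" for b k \<kappa>
    using that
    by (intro sum.reindex_bij_betw[OF bij_betw_conj_vstrips, symmetric]) (auto simp: hstrips_def)
  \<comment> \<open>The scalar turns the weight of \<open>k\<close> vertical cells into that of
    \<open>a - k\<close>. Replacing \<open>k\<close> by \<open>a - k\<close> then restores the
    weight and swaps the two strip sizes.\<close>
  have pw: "(-t) ^ a * (- inverse t) ^ k = (-t) ^ (a - k)" if "k \<le> a" for k
  proof -
    have "(-t) ^ a = (-t) ^ (a - k) * (-t) ^ k"
      using that by (simp add: power_add[symmetric])
    moreover have "(-t) ^ k * (- inverse t) ^ k = 1"
      using assms(2) by (simp add: power_mult_distrib[symmetric])
    ultimately show ?thesis
      by (simp add: mult.assoc)
  qed
  have "mconst ((-t) ^ a) * hl_q r (inverse t) a * schur r ?p =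
      (\<Sum>k\<le>a. mconst ((-t) ^ a * (- inverse t) ^ k) *
        (\<Sum>\<kappa>\<in>vstrips k ?p. \<Sum>\<nu>\<in>hstrips (a - k) \<kappa>. schur r \<nu>))"
    by (simp add: mult.assoc hl_q_schur_vh is_partition_conj assms sum_distrib_left mconst_mult)
  also have "\<dots> = (\<Sum>k\<le>a. mconst ((-t) ^ (a - k)) *
        (\<Sum>\<kappa>\<in>vstrips k ?p. \<Sum>\<nu>\<in>hstrips (a - k) \<kappa>. schur r \<nu>))"
    by (rule sum.cong) (auto simp: pw)
  also have "\<dots> = (\<Sum>k\<le>a. mconst ((-t) ^ k) *
        (\<Sum>\<kappa>\<in>vstrips (a - k) ?p. \<Sum>\<nu>\<in>hstrips k \<kappa>. schur r \<nu>))"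
    by (rule sum.reindex_bij_witness[where i = "\<lambda>k. a - k" and j = "\<lambda>k. a - k"]) auto
  also have "\<dots> = (\<Sum>k\<le>a. mconst ((-t) ^ k) *
        (\<Sum>\<kappa>\<in>hstrips (a - k) p. \<Sum>\<nu>\<in>hstrips k (part_conj \<kappa>). schur r \<nu>))"
    by (simp add: sum.reindex_bij_betw[OF bij_betw_conj_hstrips[OF assms(1)],
        of "\<lambda>\<kappa>. \<Sum>\<nu>\<in>hstrips _ \<kappa>. schur r \<nu>", symmetric])
  also have "\<dots> = (\<Sum>k\<le>a. mconst ((-t) ^ k) *
        (\<Sum>\<kappa>\<in>hstrips (a - k) p. \<Sum>\<nu>\<in>vstrips k \<kappa>. schur r (part_conj \<nu>)))"
    by (simp add: inner cong: sum.cong_simp)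
  finally show ?thesis .
qed

section \<open>Conjugation of Schur expansions\<close>

definition multipartitions_of :: "nat \<Rightarrow> ('m::finite \<Rightarrow> nat \<Rightarrow> nat) set" where
  "multipartitions_of n = {\<mu> \<in> multipartitions. mpart_size \<mu> = n}"

lemma finite_multipartitions_of [simp]: "finite (multipartitions_of n)"
proof (rule finite_subset)
  let ?P = "{p. is_partition p \<and> part_size p \<le> n}"
  have "part_size (\<mu> r) \<le> mpart_size \<mu>" for \<mu> :: "'a \<Rightarrow> nat \<Rightarrow> nat" and r
    unfolding mpart_size_def by (rule member_le_sum) auto
  thus "multipartitions_of n \<subseteq> {\<mu> :: 'a \<Rightarrow> nat \<Rightarrow> nat. \<forall>r. (r \<in> UNIV \<longrightarrow> \<mu> r \<in> ?P) \<and> (r \<notin> UNIV \<longrightarrow> \<mu> r = (\<lambda>_. 0))}"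
    by (auto simp: multipartitions_of_def multipartitions_def)
  show "finite {\<mu> :: 'a \<Rightarrow> nat \<Rightarrow> nat. \<forall>r. (r \<in> UNIV \<longrightarrow> \<mu> r \<in> ?P) \<and> (r \<notin> UNIV \<longrightarrow> \<mu> r = (\<lambda>_. 0))}"
    by (rule finite_set_of_finite_funs) (auto intro: finite_partitions)
qed

lemma mpart_conj_in_multipartitions_of:
  "\<mu> \<in> multipartitions_of n \<Longrightarrow> mpart_conj \<mu> \<in> multipartitions_of n"
  by (simp add: multipartitions_of_def multipartitions_def mpart_conj_def mpart_size_def
      is_partition_conj part_size_conj)

lemma mpart_conj_conj:
  "\<mu> \<in> multipartitions \<Longrightarrow> mpart_conj (mpart_conj \<mu>) = \<mu>"
  by (auto simp: multipartitions_def mpart_conj_def part_conj_conj)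

lemma bij_betw_mpart_conj: "bij_betw mpart_conj (multipartitions_of n) (multipartitions_of n)"
proof (rule bij_betw_byWitness[where f' = mpart_conj])
qed (auto simp: mpart_conj_in_multipartitions_of, auto simp: mpart_conj_conj multipartitions_of_def)

lemma mpart_conj_upd: "mpart_conj (\<mu>(r := p)) = (mpart_conj \<mu>)(r := part_conj p)"
  by (auto simp: mpart_conj_def)

text \<open>Isolates one alphabet, so that expansions in a single alphabet apply to
  multipartitions.\<close>

lemma mschur_upd: "mschur (\<mu>(r := p)) = schur r p * (\<Prod>r'\<in>UNIV - {r}. schur r' (\<mu> r'))"
  unfolding mschur_def by (subst prod.remove[of _ r]) simp_all

lemma mpart_size_upd:
  "part_size p = part_size (\<mu> r) + a \<Longrightarrow> mpart_size (\<mu>(r := p)) = mpart_size \<mu> + a"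
  unfolding mpart_size_def by (simp add: sum.remove[of UNIV r])

text \<open>\<open>G\<close> is the image of \<open>F\<close> under the involution \<open>\<omega>\<close> in all alphabets, for \<open>F\<close> homogeneous
  of degree \<open>n\<close>.\<close>

definition omega_pair ::
  "nat \<Rightarrow> ('m::finite \<times> nat, 'a::comm_ring_1) mfps \<Rightarrow> ('m \<times> nat, 'a) mfps \<Rightarrow> bool" where
  "omega_pair n F G \<longleftrightarrow> (\<exists>c. F = (\<Sum>\<mu>\<in>multipartitions_of n. mconst (c \<mu>) * mschur \<mu>) \<and>
     G = (\<Sum>\<mu>\<in>multipartitions_of n. mconst (c \<mu>) * mschur (mpart_conj \<mu>)))"

lemma omega_pair_0: "omega_pair n 0 0"
  unfolding omega_pair_def by (rule exI[of _ "\<lambda>_. 0"]) simp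

lemma omega_pair_add:
  assumes "omega_pair n F G" "omega_pair n F' G'"
  shows "omega_pair n (F + F') (G + G')"
proof -
  obtain c c' where
    "F = (\<Sum>\<mu>\<in>multipartitions_of n. mconst (c \<mu>) * mschur \<mu>)"
    "G = (\<Sum>\<mu>\<in>multipartitions_of n. mconst (c \<mu>) * mschur (mpart_conj \<mu>))"
    "F' = (\<Sum>\<mu>\<in>multipartitions_of n. mconst (c' \<mu>) * mschur \<mu>)"
    "G' = (\<Sum>\<mu>\<in>multipartitions_of n. mconst (c' \<mu>) * mschur (mpart_conj \<mu>))"
    using assms unfolding omega_pair_def by blast
  thus ?thesis
    unfolding omega_pair_def
    by (intro exI[of _ "\<lambda>\<mu>. c \<mu> + c' \<mu>"]) (simp add: mconst_add distrib_right sum.distrib)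
qed

lemma omega_pair_mconst_mult:
  assumes "omega_pair n F G"
  shows "omega_pair n (mconst k * F) (mconst k * G)"
proof -
  obtain c where
    "F = (\<Sum>\<mu>\<in>multipartitions_of n. mconst (c \<mu>) * mschur \<mu>)"
    "G = (\<Sum>\<mu>\<in>multipartitions_of n. mconst (c \<mu>) * mschur (mpart_conj \<mu>))"
    using assms unfolding omega_pair_def by blast
  thus ?thesis
    unfolding omega_pair_def
    by (intro exI[of _ "\<lambda>\<mu>. k * c \<mu>"]) (simp add: mconst_mult sum_distrib_left mult.assoc)
qed

lemma omega_pair_sum:
  "(\<And>x. x \<in> A \<Longrightarrow> omega_pair n (F x) (G x)) \<Longrightarrow> omega_pair n (sum F A) (sum G A)"
  by (induction A rule: infinite_finite_induct) (auto intro: omega_pair_0 omega_pair_add)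

lemma omega_pair_mschur:
  assumes "\<mu> \<in> multipartitions_of n"
  shows "omega_pair n (mschur \<mu>) (mschur (mpart_conj \<mu>))"
proof -
  have *: "(\<Sum>\<nu>\<in>multipartitions_of n. mconst (if \<nu> = \<mu> then 1 else 0) * f \<nu>) = f \<mu>"
    for f :: "('a \<Rightarrow> nat \<Rightarrow> nat) \<Rightarrow> ('a \<times> nat, 'b) mfps"
  proof -
    have "(\<Sum>\<nu>\<in>multipartitions_of n. mconst (if \<nu> = \<mu> then 1 else 0) * f \<nu>) =
        (\<Sum>\<nu>\<in>multipartitions_of n. if \<nu> = \<mu> then f \<nu> else 0)"
      by (rule sum.cong) auto
    thus ?thesis
      using assms by simp
  qed
  show ?thesis
    unfolding omega_pair_def by (rule exI[of _ "\<lambda>\<nu>. if \<nu> = \<mu> then 1 else 0"]) (simp only: *)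
qed

lemma omega_pair_hl_q_mschur:
  fixes t :: "'a::field" and r :: "'m::finite"
  assumes "\<mu> \<in> multipartitions_of n" "t \<noteq> 0"
  shows "omega_pair (n + a) (hl_q r t a * mschur \<mu>)
           (mconst ((-t) ^ a) * hl_q r (inverse t) a * mschur (mpart_conj \<mu>))"
proof -
  have p: "is_partition (\<mu> r)"
    using assms by (auto simp: multipartitions_of_def multipartitions_def)
  \<comment> \<open>The trivial update brings \<open>mschur \<mu>\<close> into the form of
    \<open>mschur_upd\<close>.\<close>
  have "hl_q r t a * mschur (\<mu>(r := \<mu> r)) = (\<Sum>k\<le>a. mconst ((-t) ^ k) *
      (\<Sum>\<kappa>\<in>hstrips (a - k) (\<mu> r). \<Sum>\<nu>\<in>vstrips k \<kappa>. mschur (\<mu>(r := \<nu>))))"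
    unfolding mschur_upd mult.assoc[symmetric] hl_q_schur_hv[OF p] by (simp add: sum_distrib_right mult.assoc)
  hence 1: "hl_q r t a * mschur \<mu> = (\<Sum>k\<le>a. mconst ((-t) ^ k) *
      (\<Sum>\<kappa>\<in>hstrips (a - k) (\<mu> r). \<Sum>\<nu>\<in>vstrips k \<kappa>. mschur (\<mu>(r := \<nu>))))"
    by simp
  have "mconst ((-t) ^ a) * hl_q r (inverse t) a * mschur (mpart_conj (\<mu>(r := \<mu> r))) =
      (\<Sum>k\<le>a. mconst ((-t) ^ k) *
      (\<Sum>\<kappa>\<in>hstrips (a - k) (\<mu> r). \<Sum>\<nu>\<in>vstrips k \<kappa>. mschur (mpart_conj (\<mu>(r := \<nu>)))))"
    unfolding mpart_conj_upd mschur_upd mult.assoc[symmetric] hl_q_schur_conj[OF p assms(2)]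
    by (simp add: sum_distrib_right mult.assoc)
  hence 2: "mconst ((-t) ^ a) * hl_q r (inverse t) a * mschur (mpart_conj \<mu>) =
      (\<Sum>k\<le>a. mconst ((-t) ^ k) *
      (\<Sum>\<kappa>\<in>hstrips (a - k) (\<mu> r). \<Sum>\<nu>\<in>vstrips k \<kappa>. mschur (mpart_conj (\<mu>(r := \<nu>)))))"
    by simp
  show ?thesis
    unfolding 1 2
  proof (intro omega_pair_sum omega_pair_mconst_mult omega_pair_mschur)
    fix k \<kappa> \<nu>
    assume "k \<in> {..a}" "\<kappa> \<in> hstrips (a - k) (\<mu> r)" "\<nu> \<in> vstrips k \<kappa>"
    hence \<nu>: "is_partition \<nu>" "part_size \<nu> = part_size (\<mu> r) + a"
      by (auto simp: hstrips_def vstrips_def)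
    show "\<mu>(r := \<nu>) \<in> multipartitions_of (n + a)"
      using assms(1) \<nu> mpart_size_upd[where \<mu> = \<mu> and r = r, OF \<nu>(2)] by (auto simp: multipartitions_of_def multipartitions_def)
  qed
qed

lemma omega_pair_hl_q:
  fixes t :: "'a::field" and r :: "'m::finite"
  assumes "omega_pair n F G" "t \<noteq> 0"
  shows "omega_pair (n + a) (hl_q r t a * F) (mconst ((-t) ^ a) * hl_q r (inverse t) a * G)"
proof -
  obtain c where
    F: "F = (\<Sum>\<mu>\<in>multipartitions_of n. mconst (c \<mu>) * mschur \<mu>)" and
    G: "G = (\<Sum>\<mu>\<in>multipartitions_of n. mconst (c \<mu>) * mschur (mpart_conj \<mu>))"
    using assms unfolding omega_pair_def by blast
  have "omega_pair (n + a)
      (\<Sum>\<mu>\<in>multipartitions_of n. mconst (c \<mu>) * (hl_q r t a * mschur \<mu>))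
      (\<Sum>\<mu>\<in>multipartitions_of n. mconst (c \<mu>) *
        (mconst ((-t) ^ a) * hl_q r (inverse t) a * mschur (mpart_conj \<mu>)))"
    by (intro omega_pair_sum omega_pair_mconst_mult omega_pair_hl_q_mschur assms)
  thus ?thesis
    by (simp add: F G sum_distrib_left mult_ac)
qed

text \<open>The scalar depends only on the total degree, so it will be common to all compositions of
  \<open>a\<close> in \<open>shoji_q\<close>.\<close>

lemma omega_pair_prod_hl_q:
  fixes t :: "'a::field"
  assumes "omega_pair n F G" "t \<noteq> 0" "finite R"
  shows "omega_pair (n + sum c R) ((\<Prod>r\<in>R. hl_q r t (c r)) * F)
           (mconst ((-t) ^ sum c R) * (\<Prod>r\<in>R. hl_q r (inverse t) (c r)) * G)"
  using assms(3)
proof (induction R rule: finite_induct)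
  case empty
  with assms(1) show ?case
    by simp
next
  case (insert r R)
  from omega_pair_hl_q[OF insert.IH assms(2), of "c r" r] insert.hyps show ?case
    by (simp add: power_add mconst_mult mult_ac add_ac)
qed

text \<open>Letters are fixed and \<open>t\<close> enters only through coefficients; comparing the
  finite products is enough.\<close>

lemma (in ring_hom_on_coeffs) mmap_hl_q:
  fixes r :: 'm
  shows "mmap f (hl_q r t a) = hl_q r (f t) a"
proof (rule mfps_eq_mrestrI)
  fix N
  have diff: "f (x - y) = f x - f y" for x y
    using add[of "x - y" y] by simp
  have gen: "mmap f (fps_nth (hl_gen r t N) a) = fps_nth (hl_gen r (f t) N) a" for N a
  proof (induction N arbitrary: a)
    case 0
    show ?case
      by (simp add: hl_gen_def fps_one_nth mmap_1 zero mfps_eqI)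
  next
    case (Suc N)
    define g where
      "g = (1 - fps_const (mconst t * mvar (r, N)) * fps_X) * Abs_fps (\<lambda>d. mvar (r, N) ^ d)"
    define g' where
      "g' = (1 - fps_const (mconst (f t) * mvar (r, N)) * fps_X) * Abs_fps (\<lambda>d. mvar (r, N) ^ d)"
    have "mmap f (mvar (r, N) ^ n) = mvar (r, N) ^ n" for n
      by (induction n) (simp_all add: mmap_1 mmap_mult mmap_mvar)
    hence "mmap f (fps_nth g n) = fps_nth g' n" for n
      by (simp add: g_def g'_def hl_factor_nth mmap_1 mmap_mult mmap_mconst diff one)
    moreover have "hl_gen r t (Suc N) = hl_gen r t N * g" "hl_gen r (f t) (Suc N) = hl_gen r (f t) N * g'"
      by (simp_all add: hl_gen_def g_def g'_def lessThan_Suc mult.commute)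
    ultimately show ?case
      by (simp add: fps_mult_nth mmap_sum mmap_mult Suc.IH)
  qed
  have "mrestr S (mmap f F) = mmap f (mrestr S F)" for S :: "('m \<times> nat) set" and F
    by (rule mfps_eqI) (auto simp: mcoeff_mrestr zero)
  thus "mrestr (letters N) (mmap f (hl_q r t a)) = mrestr (letters N) (hl_q r (f t) a)"
    by (simp add: mrestr_hl_q gen)
qed

section \<open>Linear independence of the Schur functions\<close>

text \<open>Weighting a letter by its index, the monomial of least weight in \<open>schur r p\<close> is that of the
  tableau whose \<open>i\<close>-th row is constantly \<open>i\<close>, and its exponents are the parts of \<open>p\<close>.\<close>

definition index_weight :: "('m \<times> nat \<Rightarrow>\<^sub>0 nat) \<Rightarrow> nat" where
  "index_weight e = (\<Sum>v\<in>Poly_Mapping.keys e. snd v * Poly_Mapping.lookup e v)"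

lemma index_weight_eq:
  assumes "finite A" "Poly_Mapping.keys e \<subseteq> A"
  shows "index_weight e = (\<Sum>v\<in>A. snd v * Poly_Mapping.lookup e v)"
  unfolding index_weight_def
  by (rule sum.mono_neutral_left) (use assms in \<open>auto simp: in_keys_iff\<close>)

lemma index_weight_0 [simp]: "index_weight 0 = 0"
  by (simp add: index_weight_def)

lemma index_weight_add: "index_weight (a + b) = index_weight a + index_weight b"
proof -
  let ?A = "Poly_Mapping.keys a \<union> Poly_Mapping.keys b"
  have "index_weight (a + b) = (\<Sum>v\<in>?A. snd v * Poly_Mapping.lookup (a + b) v)"
    by (rule index_weight_eq) (simp_all add: Poly_Mapping.keys_add)
  also have "\<dots> = index_weight a + index_weight b"
    by (simp add: index_weight_eq[of ?A a] index_weight_eq[of ?A b] lookup_add distrib_left sum.distrib)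
  finally show ?thesis .
qed

lemma index_weight_sum: "index_weight (sum f A) = (\<Sum>x\<in>A. index_weight (f x))"
  by (induction A rule: infinite_finite_induct) (simp_all add: index_weight_add)

lemma index_weight_single: "index_weight (Poly_Mapping.single (r, k) (Suc 0)) = k"
  by (simp add: index_weight_def)

lemma index_weight_ssyt_weight:
  "index_weight (ssyt_weight r p T) = (\<Sum>(i, j)\<in>cells p. T i j)"
  by (simp add: ssyt_weight_def index_weight_sum index_weight_single case_prod_unfold)

text \<open>Least and not greatest weight, since a series in infinitely many letters may have terms
  of unbounded weight.\<close>

definition leading :: "('m \<times> nat, 'a::comm_ring_1) mfps \<Rightarrow> ('m \<times> nat \<Rightarrow>\<^sub>0 nat) \<Rightarrow> bool" where
  "leading F e0 \<longleftrightarrow> mcoeff F e0 = 1 \<and>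
     (\<forall>e. mcoeff F e \<noteq> 0 \<longrightarrow> e = e0 \<or> index_weight e0 < index_weight e)"

lemma leading_1: "leading 1 0"
  by (simp add: leading_def mcoeff_one)

text \<open>Weights add under multiplication, so every other pair of contributing monomials is
  strictly heavier and nothing can cancel the product of the two leading terms.\<close>

lemma leading_mult:
  assumes "leading F a" "leading G b"
  shows "leading (F * G) (a + b)"
proof -
  have F: "mcoeff F a = 1" "\<And>x. mcoeff F x \<noteq> 0 \<Longrightarrow> x = a \<or> index_weight a < index_weight x"
    and G: "mcoeff G b = 1" "\<And>x. mcoeff G x \<noteq> 0 \<Longrightarrow> x = b \<or> index_weight b < index_weight x"
    using assms by (auto simp: leading_def)
  have dichotomy: "x = a \<and> y = b \<or> index_weight (a + b) < index_weight (x + y)"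
    if "mcoeff F x * mcoeff G y \<noteq> 0" for x y
  proof -
    have "mcoeff F x \<noteq> 0" "mcoeff G y \<noteq> 0"
      using that by auto
    from F(2)[OF this(1)] G(2)[OF this(2)] show ?thesis
      by (auto simp: index_weight_add)
  qed
  have "mcoeff (F * G) (a + b) = (\<Sum>(x, y)\<in>{(a, b)}. mcoeff F x * mcoeff G y)"
    unfolding mcoeff_mult
  proof (rule sum.mono_neutral_right[OF finite_splits])
    have "mcoeff F x * mcoeff G y = 0" if "(x, y) \<in> splits (a + b)" "(x, y) \<noteq> (a, b)" for x y
      using that dichotomy[of x y] by (auto simp: splits_def)
    thus "\<forall>z\<in>splits (a + b) - {(a, b)}. (case z of (x, y) \<Rightarrow> mcoeff F x * mcoeff G y) = 0"
      by (auto simp del: mult_eq_0_iff)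
  qed (simp add: splits_def)
  moreover have "e = a + b \<or> index_weight (a + b) < index_weight e" if nz: "mcoeff (F * G) e \<noteq> 0" for e
  proof -
    obtain z where z: "z \<in> splits e" "(case z of (x, y) \<Rightarrow> mcoeff F x * mcoeff G y) \<noteq> 0"
      using nz unfolding mcoeff_mult by (rule sum.not_neutral_contains_not_neutral)
    obtain x y where "z = (x, y)"
      by (cases z)
    with z dichotomy[of x y] show ?thesis
      by (auto simp: splits_def)
  qed
  ultimately show ?thesis
    using F(1) G(1) by (auto simp: leading_def)
qed

lemma leading_prod:
  "finite A \<Longrightarrow> (\<And>x. x \<in> A \<Longrightarrow> leading (F x) (e x)) \<Longrightarrow> leading (prod F A) (sum e A)"
  by (induction A rule: finite_induct) (auto intro: leading_1 leading_mult)

definition row_tab :: "(nat \<Rightarrow> nat) \<Rightarrow> nat \<Rightarrow> nat \<Rightarrow> nat" where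
  "row_tab p i j = (if j < p i then i else 0)"

lemma is_ssyt_row_tab: "is_partition p \<Longrightarrow> is_ssyt p (row_tab p)"
  using is_partitionD[of p] by (auto simp: is_ssyt_def row_tab_def intro: less_le_trans)

text \<open>Going down a column, entries start at 0 or above and increase by at least 1 per
  row.\<close>

lemma ssyt_ge_row:
  assumes "is_ssyt p T" "is_partition p" "j < p i"
  shows "i \<le> T i j"
  using assms(3)
proof (induction i)
  case (Suc i)
  have "j < p i"
    using Suc.prems is_partitionD[OF assms(2), of i "Suc i"] by simp
  hence "i \<le> T i j"
    by (rule Suc.IH)
  moreover have "T i j < T (Suc i) j"
    using assms(1) Suc.prems by (auto simp: is_ssyt_def)
  ultimately show ?case
    by simp
qed simp

lemma ssyt_row_tab_or_heavier:
  assumes "is_ssyt p T" "is_partition p"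
  shows "T = row_tab p \<or> index_weight (ssyt_weight r p (row_tab p)) < index_weight (ssyt_weight r p T)"
proof (cases "\<forall>i j. j < p i \<longrightarrow> T i j = i")
  case True
  hence "T = row_tab p"
    using assms(1) by (intro ext) (auto simp: row_tab_def is_ssyt_def)
  thus ?thesis ..
next
  case False
  then obtain i j where ij: "j < p i" "T i j \<noteq> i"
    by blast
  have "(\<Sum>(i, j)\<in>cells p. row_tab p i j) < (\<Sum>(i, j)\<in>cells p. T i j)"
  proof (rule sum_strict_mono_ex1[OF finite_cells[OF assms(2)]])
    show "\<forall>x\<in>cells p. (case x of (i, j) \<Rightarrow> row_tab p i j) \<le> (case x of (i, j) \<Rightarrow> T i j)"
      using ssyt_ge_row[OF assms] by (auto simp: row_tab_def)
    show "\<exists>x\<in>cells p. (case x of (i, j) \<Rightarrow> row_tab p i j) < (case x of (i, j) \<Rightarrow> T i j)"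
      by (rule bexI[of _ "(i, j)"]) (use ij ssyt_ge_row[OF assms ij(1)] in \<open>auto simp: row_tab_def\<close>)
  qed
  thus ?thesis
    by (simp add: index_weight_ssyt_weight)
qed

lemma leading_schur:
  assumes "is_partition p"
  shows "leading (schur r p) (ssyt_weight r p (row_tab p))"
proof -
  have "{T. is_ssyt p T \<and> ssyt_weight r p T = ssyt_weight r p (row_tab p)} = {row_tab p}"
    using is_ssyt_row_tab[OF assms] ssyt_row_tab_or_heavier[OF _ assms, of _ r] by fastforce
  hence "mcoeff (schur r p) (ssyt_weight r p (row_tab p)) = 1"
    by (simp add: schur_def)
  moreover have "e = ssyt_weight r p (row_tab p) \<or> index_weight (ssyt_weight r p (row_tab p)) < index_weight e"
    if nz: "mcoeff (schur r p :: ('a \<times> nat, 'b) mfps) e \<noteq> 0" for e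
  proof -
    have "{T. is_ssyt p T \<and> ssyt_weight r p T = e} \<noteq> {}"
    proof
      assume "{T. is_ssyt p T \<and> ssyt_weight r p T = e} = {}"
      with nz show False
        by (simp add: schur_def)
    qed
    then obtain T where "is_ssyt p T" "ssyt_weight r p T = e"
      by auto
    with ssyt_row_tab_or_heavier[OF this(1) assms, of r] show ?thesis
      by auto
  qed
  ultimately show ?thesis
    by (simp add: leading_def)
qed

definition leading_exp :: "('m::finite \<Rightarrow> nat \<Rightarrow> nat) \<Rightarrow> 'm \<times> nat \<Rightarrow>\<^sub>0 nat" where
  "leading_exp \<mu> = (\<Sum>r\<in>UNIV. ssyt_weight r (\<mu> r) (row_tab (\<mu> r)))"

lemma leading_mschur:
  "\<mu> \<in> multipartitions \<Longrightarrow>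
    leading (mschur \<mu> :: ('m::finite \<times> nat, 'a::comm_ring_1) mfps) (leading_exp \<mu>)"
  unfolding mschur_def leading_exp_def
  by (rule leading_prod) (auto simp: multipartitions_def leading_schur)

lemma lookup_leading_exp:
  assumes "\<mu> \<in> multipartitions"
  shows "Poly_Mapping.lookup (leading_exp \<mu>) (r, i) = \<mu> r i"
proof -
  have \<mu>: "is_partition (\<mu> s)" for s
    using assms by (simp add: multipartitions_def)
  have "Poly_Mapping.lookup (ssyt_weight s (\<mu> s) (row_tab (\<mu> s))) (r, i) = (if s = r then \<mu> r i else 0)" for s
  proof -
    have "{(k, j). (k, j) \<in> cells (\<mu> s) \<and> (s, row_tab (\<mu> s) k j) = (r, i)} =
        (if s = r then Pair i ` {..<\<mu> r i} else {})"
      by (auto simp: row_tab_def)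
    thus ?thesis
      by (simp add: lookup_ssyt_weight[OF \<mu>] card_image inj_on_def)
  qed
  thus ?thesis
    by (simp add: leading_exp_def lookup_sum)
qed

lemma leading_exp_inj:
  "\<mu> \<in> multipartitions \<Longrightarrow> \<nu> \<in> multipartitions \<Longrightarrow> leading_exp \<mu> = leading_exp \<nu> \<Longrightarrow> \<mu> = \<nu>"
  by (intro ext) (metis lookup_leading_exp)

text \<open>Among the shapes with nonzero coefficient, take one of least leading weight. Its leading
  monomial occurs in no other summand: a smaller weight is excluded by minimality, a tie by
  \<open>leading_exp_inj\<close>.\<close>

lemma mschur_independent:
  fixes c :: "('m::finite \<Rightarrow> nat \<Rightarrow> nat) \<Rightarrow> 'a::comm_ring_1"
  assumes "finite A" "A \<subseteq> multipartitions" "(\<Sum>\<mu>\<in>A. mconst (c \<mu>) * mschur \<mu>) = 0" "\<mu> \<in> A"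
  shows "c \<mu> = 0"
proof (rule ccontr)
  define B where "B = {\<mu> \<in> A. c \<mu> \<noteq> 0}"
  assume "c \<mu> \<noteq> 0"
  hence "B \<noteq> {}" "finite B"
    using assms(1,4) by (auto simp: B_def)
  then obtain \<nu> where \<nu>: "\<nu> \<in> B"
    "\<And>\<kappa>. \<kappa> \<in> B \<Longrightarrow> index_weight (leading_exp \<nu>) \<le> index_weight (leading_exp \<kappa>)"
    using arg_min_if_finite[of B "index_weight \<circ> leading_exp"] by (metis comp_apply leI)
  have \<nu>_mp: "\<nu> \<in> multipartitions" "\<nu> \<in> A" "c \<nu> \<noteq> 0"
    using \<nu>(1) assms(2) by (auto simp: B_def)
  note lead = leading_mschur[where 'a = 'a]
  have other: "c \<kappa> * mcoeff (mschur \<kappa>) (leading_exp \<nu>) = 0" if \<kappa>: "\<kappa> \<in> A" "\<kappa> \<noteq> \<nu>" for \<kappa>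
  proof (rule ccontr)
    assume nz: "c \<kappa> * mcoeff (mschur \<kappa>) (leading_exp \<nu>) \<noteq> 0"
    hence "c \<kappa> \<noteq> 0" "mcoeff (mschur \<kappa> :: ('m \<times> nat, 'a) mfps) (leading_exp \<nu>) \<noteq> 0"
      by auto
    moreover have "\<kappa> \<in> multipartitions"
      using \<kappa> assms(2) by auto
    ultimately have "leading_exp \<nu> = leading_exp \<kappa> \<or> index_weight (leading_exp \<kappa>) < index_weight (leading_exp \<nu>)"
      using lead[of \<kappa>] by (auto simp: leading_def)
    with \<nu>(2)[of \<kappa>] \<kappa> \<open>c \<kappa> \<noteq> 0\<close> leading_exp_inj[OF \<nu>_mp(1) \<open>\<kappa> \<in> multipartitions\<close>] show False
      by (auto simp: B_def)
  qed
  have "0 = (\<Sum>\<kappa>\<in>A. c \<kappa> * mcoeff (mschur \<kappa>) (leading_exp \<nu>))"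
    using arg_cong[OF assms(3), of "\<lambda>F. mcoeff F (leading_exp \<nu>)"] by simp
  also have "\<dots> = c \<nu> * mcoeff (mschur \<nu>) (leading_exp \<nu>)"
    using other \<nu>_mp(2) assms(1) by (subst sum.remove[of _ \<nu>]) auto
  also have "\<dots> = c \<nu>"
    using lead[OF \<nu>_mp(1)] by (auto simp: leading_def)
  finally show False
    using \<nu>_mp(3) by simp
qed

text \<open>Meets the definite description in \<open>schur_coeffs\<close>: two finite expansions are
  compared over the union of their supports, where independence applies to the difference.\<close>

lemma schur_coeffs_eq:
  fixes c :: "('m::finite \<Rightarrow> nat \<Rightarrow> nat) \<Rightarrow> 'a::comm_ring_1"
  assumes "F = (\<Sum>\<mu>\<in>multipartitions_of n. mconst (c \<mu>) * mschur \<mu>)"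
  shows "schur_coeffs F \<mu> = (if \<mu> \<in> multipartitions_of n then c \<mu> else 0)"
proof -
  define d where "d \<mu> = (if \<mu> \<in> multipartitions_of n then c \<mu> else 0)" for \<mu>
  have supp: "{\<mu>. d \<mu> \<noteq> 0} \<subseteq> multipartitions_of n"
    by (auto simp: d_def)
  have fin: "finite {\<mu>. d \<mu> \<noteq> 0}"
    using supp by (rule finite_subset) simp
  have mp: "{\<mu>. d \<mu> \<noteq> 0} \<subseteq> multipartitions"
    using supp by (auto simp: multipartitions_of_def)
  have "F = (\<Sum>\<mu>\<in>multipartitions_of n. mconst (d \<mu>) * mschur \<mu>)"
    unfolding assms by (rule sum.cong) (auto simp: d_def)
  also have "\<dots> = (\<Sum>\<mu> | d \<mu> \<noteq> 0. mconst (d \<mu>) * mschur \<mu>)"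
    by (rule sum.mono_neutral_right) (use supp in auto)
  finally have F: "F = (\<Sum>\<mu> | d \<mu> \<noteq> 0. mconst (d \<mu>) * mschur \<mu>)" .
  have "schur_coeffs F = d"
    unfolding schur_coeffs_def
  proof (rule the_equality, intro conjI)
    fix d'
    assume "finite {\<mu>. d' \<mu> \<noteq> 0} \<and> {\<mu>. d' \<mu> \<noteq> 0} \<subseteq> multipartitions \<and>
      F = (\<Sum>\<mu> | d' \<mu> \<noteq> 0. mconst (d' \<mu>) * mschur \<mu>)"
    hence d': "finite {\<mu>. d' \<mu> \<noteq> 0}" "{\<mu>. d' \<mu> \<noteq> 0} \<subseteq> multipartitions"
      "F = (\<Sum>\<mu> | d' \<mu> \<noteq> 0. mconst (d' \<mu>) * mschur \<mu>)"
      by auto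
    define A where "A = {\<mu>. d \<mu> \<noteq> 0} \<union> {\<mu>. d' \<mu> \<noteq> 0}"
    have A: "finite A" "A \<subseteq> multipartitions"
      using fin d'(1,2) mp by (auto simp: A_def)
    have "F = (\<Sum>\<mu>\<in>A. mconst (d \<mu>) * mschur \<mu>)"
      by (subst F, rule sum.mono_neutral_left) (use A(1) in \<open>auto simp: A_def\<close>)
    moreover have "F = (\<Sum>\<mu>\<in>A. mconst (d' \<mu>) * mschur \<mu>)"
      by (subst d'(3), rule sum.mono_neutral_left) (use A(1) in \<open>auto simp: A_def\<close>)
    ultimately have "(\<Sum>\<mu>\<in>A. mconst (d' \<mu> - d \<mu>) * mschur \<mu>) = 0"
      by (simp add: mconst_diff left_diff_distrib sum_subtractf)
    hence "d' \<mu> - d \<mu> = 0" if "\<mu> \<in> A" for \<mu>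
      using that by (rule mschur_independent[OF A])
    hence "d' \<mu> = d \<mu>" for \<mu>
      by (cases "\<mu> \<in> A") (auto simp: A_def)
    thus "d' = d" ..
  qed (fact fin mp F)+
  thus ?thesis
    by (simp add: d_def)
qed

lemma omega_pair_coeffs:
  assumes "omega_pair n F G" "\<mu> \<in> multipartitions"
  shows "schur_coeffs F \<mu> = schur_coeffs G (mpart_conj \<mu>)"
proof -
  obtain c where
    F: "F = (\<Sum>\<mu>\<in>multipartitions_of n. mconst (c \<mu>) * mschur \<mu>)" and
    G: "G = (\<Sum>\<mu>\<in>multipartitions_of n. mconst (c \<mu>) * mschur (mpart_conj \<mu>))"
    using assms(1) unfolding omega_pair_def by blast
  \<comment> \<open>The double conjugate puts the summand in the form of a function of
    \<open>mpart_conj \<mu>\<close>, ready for reindexing.\<close>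
  have "G = (\<Sum>\<mu>\<in>multipartitions_of n. mconst (c (mpart_conj (mpart_conj \<mu>))) * mschur (mpart_conj \<mu>))"
    unfolding G by (rule sum.cong) (auto simp: mpart_conj_conj multipartitions_of_def)
  also have "\<dots> = (\<Sum>\<mu>\<in>multipartitions_of n. mconst (c (mpart_conj \<mu>)) * mschur \<mu>)"
    by (rule sum.reindex_bij_betw[OF bij_betw_mpart_conj])
  finally have G': "G = \<dots>" .
  have "mpart_conj \<mu> \<in> multipartitions_of n \<longleftrightarrow> \<mu> \<in> multipartitions_of n"
    by (metis assms(2) mpart_conj_conj mpart_conj_in_multipartitions_of)
  thus ?thesis
    by (simp add: schur_coeffs_eq[OF F] schur_coeffs_eq[OF G'] mpart_conj_conj assms(2))
qed

lemma omega_pair_coeffs_degree: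
  assumes "omega_pair n F G" "mpart_size \<mu> \<noteq> n"
  shows "schur_coeffs F \<mu> = 0"
proof -
  obtain c where F: "F = (\<Sum>\<mu>\<in>multipartitions_of n. mconst (c \<mu>) * mschur \<mu>)"
    using assms(1) unfolding omega_pair_def by blast
  show ?thesis
    using assms(2) by (simp add: schur_coeffs_eq[OF F] multipartitions_of_def)
qed

text \<open>Schur functions are fixed by \<open>mmap f\<close>, so applying \<open>f\<close> to the
  coefficients of an expansion yields the expansion of the image.\<close>

lemma (in ring_hom_on_coeffs) omega_pair_coeffs_mmap:
  assumes "omega_pair n F G"
  shows "schur_coeffs (mmap f F) \<mu> = f (schur_coeffs F \<mu>)"
proof -
  obtain c where F: "F = (\<Sum>\<mu>\<in>multipartitions_of n. mconst (c \<mu>) * mschur \<mu>)"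
    using assms(1) unfolding omega_pair_def by blast
  hence "mmap f F = (\<Sum>\<mu>\<in>multipartitions_of n. mconst (f (c \<mu>)) * mschur \<mu>)"
    by (simp add: mmap_sum mmap_mult mmap_mconst mmap_mschur)
  thus ?thesis
    by (simp add: schur_coeffs_eq schur_coeffs_eq[OF F] zero)
qed

lemma schur_coeffs_mconst_mult:
  assumes "omega_pair n F G"
  shows "schur_coeffs (mconst k * F) \<mu> = k * schur_coeffs F \<mu>"
proof -
  obtain c where F: "F = (\<Sum>\<mu>\<in>multipartitions_of n. mconst (c \<mu>) * mschur \<mu>)"
    using assms(1) unfolding omega_pair_def by blast
  hence "mconst k * F = (\<Sum>\<mu>\<in>multipartitions_of n. mconst (k * c \<mu>) * mschur \<mu>)"
    by (simp add: sum_distrib_left mconst_mult mult.assoc)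
  thus ?thesis
    by (simp add: schur_coeffs_eq schur_coeffs_eq[OF F])
qed

section \<open>The substitution of \<open>q\<inverse>\<close> for \<open>q\<close>\<close>

text \<open>The unfolding of 0 and 1 is restricted to the outer of the two nested fraction fields.\<close>

lemma poly_fract_0: "(0 :: 'a::idom poly fract) = Fract 0 1"
  by (rule Zero_fract_def)

lemma poly_fract_1: "(1 :: 'a::idom poly fract) = Fract 1 1"
  by (rule One_fract_def)

lemma ucoeff_0 [simp]: "ucoeff 0 = 0"
  by (simp add: ucoeff_def poly_fract_0)

lemma ucoeff_1 [simp]: "ucoeff 1 = 1"
  by (simp add: ucoeff_def poly_fract_1 one_pCons)

lemma ucoeff_add: "ucoeff (x + y) = ucoeff x + ucoeff y"
  by (simp add: ucoeff_def)

lemma ucoeff_mult: "ucoeff (x * y) = ucoeff x * ucoeff y"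
  by (simp add: ucoeff_def mult.commute)

lemma ucoeff_eq_0_iff [simp]: "ucoeff x = 0 \<longleftrightarrow> x = 0"
  by (simp add: ucoeff_def poly_fract_0 eq_fract)

section \<open>Evaluation of polynomials at 1/q and its extension to fractions\<close>

lemma poly_at_qinv_0 [simp]: "poly_at_qinv 0 = 0"
  by (simp add: poly_at_qinv_def)

lemma poly_at_qinv_pCons: "poly_at_qinv (pCons a f) = ucoeff a + inverse qpar * poly_at_qinv f"
  by (simp add: poly_at_qinv_def map_poly_pCons)

lemma poly_at_qinv_1 [simp]: "poly_at_qinv 1 = 1"
  by (simp add: one_pCons poly_at_qinv_pCons)

lemma poly_at_qinv_add: "poly_at_qinv (f + g) = poly_at_qinv f + poly_at_qinv g"
  by (induction f g rule: poly_induct2) (simp_all add: poly_at_qinv_pCons ucoeff_add algebra_simps)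

lemma poly_at_qinv_smult: "poly_at_qinv (smult c f) = ucoeff c * poly_at_qinv f"
  by (induction f) (simp_all add: poly_at_qinv_pCons ucoeff_mult algebra_simps)

lemma poly_at_qinv_mult: "poly_at_qinv (f * g) = poly_at_qinv f * poly_at_qinv g"
  by (induction f)
     (simp_all add: poly_at_qinv_pCons poly_at_qinv_add poly_at_qinv_smult algebra_simps)

lemma qpar_neq_0 [simp]: "qpar \<noteq> 0"
  by (simp add: qpar_def poly_fract_0 eq_fract)

lemma qpar_neq_1 [simp]: "qpar \<noteq> 1"
  by (simp add: qpar_def poly_fract_1 eq_fract one_pCons)

text \<open>Evaluation at q is the embedding of polynomials into their fraction field; in other
  words, q is transcendental over the field of the u.\<close>

lemma poly_map_ucoeff_qpar: "poly (map_poly ucoeff f) qpar = Fract f 1"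
proof (induction f)
  case 0
  show ?case
    by (simp add: poly_fract_0)
next
  case (pCons a f)
  have "poly (map_poly ucoeff (pCons a f)) qpar = ucoeff a + qpar * Fract f 1"
    by (simp add: map_poly_pCons pCons.IH)
  also have "\<dots> = Fract (pCons a f) 1"
    by (simp add: ucoeff_def qpar_def)
  finally show ?case .
qed

text \<open>Up to a power of q, the value at 1/q is the value at q of the reflected polynomial, and
  that embeds injectively. Denominators therefore stay nonzero under the substitution.\<close>

lemma poly_at_qinv_eq_0_iff [simp]: "poly_at_qinv f = 0 \<longleftrightarrow> f = 0"
proof
  assume f: "poly_at_qinv f = 0"
  have deg: "degree (map_poly ucoeff f) = degree f"
    by (rule degree_map_poly) simp
  have "map_poly ucoeff (reflect_poly f) = reflect_poly (map_poly ucoeff f)"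
    by (rule poly_eqI) (simp add: coeff_map_poly coeff_reflect_poly deg)
  hence "Fract (reflect_poly f) 1 = poly (reflect_poly (map_poly ucoeff f)) qpar"
    using poly_map_ucoeff_qpar[of "reflect_poly f"] by simp
  also have "\<dots> = qpar ^ degree f * poly_at_qinv f"
    by (simp add: poly_reflect_poly_nz poly_at_qinv_def deg)
  finally have "Fract (reflect_poly f) 1 = 0"
    using f by simp
  thus "f = 0"
    by (simp add: poly_fract_0 eq_fract)
qed simp

text \<open>Equal fractions cross-multiply, and \<open>poly_at_qinv\<close> respects products and
  nonzero denominators. So all representatives give one value, as the definite description
  requires.\<close>

lemma at_qinv_Fract:
  assumes "g \<noteq> 0"
  shows "at_qinv (Fract f g) = poly_at_qinv f / poly_at_qinv g"
  unfolding at_qinv_def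
proof (rule the_equality)
  show "\<forall>f' g'. g' \<noteq> 0 \<longrightarrow> Fract f g = Fract f' g' \<longrightarrow>
      poly_at_qinv f / poly_at_qinv g = poly_at_qinv f' / poly_at_qinv g'"
  proof (intro allI impI)
    fix f' g'
    assume g': "g' \<noteq> 0" and "Fract f g = Fract f' g'"
    hence "f * g' = f' * g"
      by (simp add: eq_fract assms)
    hence "poly_at_qinv f * poly_at_qinv g' = poly_at_qinv f' * poly_at_qinv g"
      by (simp add: poly_at_qinv_mult[symmetric])
    thus "poly_at_qinv f / poly_at_qinv g = poly_at_qinv f' / poly_at_qinv g'"
      by (simp add: frac_eq_eq assms g')
  qed
qed (use assms in blast)

interpretation at_qinv: ring_hom_on_coeffs at_qinv
proof
  show "at_qinv 0 = 0" "at_qinv 1 = 1"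
    by (simp_all add: poly_fract_0 poly_fract_1 at_qinv_Fract )
  fix x y :: "'a qufield"
  obtain f g where x: "x = Fract f g" "g \<noteq> 0"
    by (cases x) auto
  obtain f' g' where y: "y = Fract f' g'" "g' \<noteq> 0"
    by (cases y) auto
  show "at_qinv (x + y) = at_qinv x + at_qinv y"
    using x y by (simp add: at_qinv_Fract poly_at_qinv_add poly_at_qinv_mult add_frac_eq)
  show "at_qinv (x * y) = at_qinv x * at_qinv y"
    using x y by (simp add: at_qinv_Fract poly_at_qinv_mult)
qed

lemma at_qinv_ucoeff: "at_qinv (ucoeff c) = ucoeff c"
  by (simp add: ucoeff_def at_qinv_Fract poly_at_qinv_pCons)

lemma at_qinv_upar [simp]: "at_qinv (upar r) = upar r"
  by (simp add: upar_def at_qinv_ucoeff)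

lemma at_qinv_qpar [simp]: "at_qinv qpar = inverse qpar"
proof -
  have "at_qinv qpar = at_qinv (Fract [:0, 1:] 1)"
    by (simp only: qpar_def)
  also have "\<dots> = inverse qpar"
    by (simp add: at_qinv_Fract poly_at_qinv_pCons)
  finally show ?thesis .
qed

lemma at_qinv_power: "at_qinv (x ^ n) = at_qinv x ^ n"
  by (induction n) (simp_all add: at_qinv.one at_qinv.mult)

lemma at_qinv_diff: "at_qinv (x - y) = at_qinv x - at_qinv y"
  using at_qinv.add[of "x - y" y] by simp

lemma at_qinv_inverse: "at_qinv (inverse x) = inverse (at_qinv x)"
proof (cases "x = 0")
  case False
  hence "at_qinv x * at_qinv (inverse x) = 1"
    by (simp add: at_qinv.mult[symmetric] at_qinv.one)
  thus ?thesis
    by (rule inverse_unique[symmetric])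
qed (simp add: at_qinv.zero)

lemma at_qinv_divide: "at_qinv (x / y) = at_qinv x / at_qinv y"
  by (simp add: divide_inverse at_qinv.mult at_qinv_inverse)


section \<open>Products of the functions of Shoji's formula\<close>

lemma mmap_at_qinv_shoji_q:
  "mmap at_qinv (shoji_q i a) = mconst (inverse qpar ^ a / (inverse qpar - 1)) *
     (\<Sum>c | sum c UNIV = a. mconst (upar (Max {r. c r \<noteq> 0}) ^ card {..<i}) *
        (\<Prod>r\<in>UNIV. hl_q r qpar (c r)))"
  by (simp add: shoji_q_def at_qinv.mmap_mult at_qinv.mmap_mconst at_qinv.mmap_sum at_qinv.mmap_prod
      at_qinv.mmap_hl_q at_qinv_divide at_qinv_power at_qinv_diff at_qinv_inverse at_qinv.one)

text \<open>Both sides equal (-1)^a / (x - 1). One power of \<open>- x\<close> is absorbed by the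
  change of denominator, and collecting one per factor produces the length of the array in the final
  exponent.\<close>

lemma shoji_scalar:
  fixes x :: "'a::field"
  assumes "x \<noteq> 0" "x \<noteq> 1" "a > 0"
  shows "x ^ a / (x - 1) * (- inverse x) ^ a = (- x) ^ (a - 1) * (inverse x ^ a / (inverse x - 1))"
proof -
  obtain b where a: "a = Suc b"
    using assms(3) by (cases a) auto
  have "x ^ a / (x - 1) * (- inverse x) ^ a = (x * - inverse x) ^ a / (x - 1)"
    by (simp only: power_mult_distrib times_divide_eq_left)
  also have "\<dots> = (-1) ^ b * - (1 / (x - 1))"
    using assms(1) by (simp add: a)
  also have "- (1 / (x - 1)) = inverse x / (inverse x - 1)"
    using assms by (simp add: field_simps)
  also have "(-1) ^ b = (- x * inverse x) ^ b"
    using assms(1) by simp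
  also have "\<dots> * (inverse x / (inverse x - 1)) = (- x) ^ b * (inverse x ^ a / (inverse x - 1))"
    by (simp only: a power_mult_distrib power_Suc mult_ac times_divide_eq_left times_divide_eq_right)
  finally show ?thesis
    by (simp add: a)
qed

text \<open>The factor in u depends on \<open>c\<close> alone and the scalar on \<open>a\<close>
  alone, so both pass through the sum over compositions.\<close>

lemma omega_pair_shoji_q:
  assumes "omega_pair n F G" "a > 0"
  shows "omega_pair (n + a) (shoji_q i a * F)
           (mconst ((- qpar) ^ (a - 1)) * mmap at_qinv (shoji_q i a) * G)"
proof -
  let ?u = "\<lambda>c. mconst (upar (Max {r. c r \<noteq> 0}) ^ card {..<i})"
  define s where "s = (qpar ^ a / (qpar - 1) :: 'a qufield)"
  have "omega_pair (n + a)
     (mconst s * (\<Sum>c | sum c UNIV = a. ?u c * ((\<Prod>r\<in>UNIV. hl_q r (inverse qpar) (c r)) * F)))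
     (mconst s * (\<Sum>c | sum c UNIV = a. ?u c * (mconst ((- inverse qpar) ^ a) *
        (\<Prod>r\<in>UNIV. hl_q r qpar (c r)) * G)))"
  proof (intro omega_pair_mconst_mult omega_pair_sum)
    fix c :: "'a \<Rightarrow> nat"
    assume "c \<in> {c. sum c UNIV = a}"
    thus "omega_pair (n + a) ((\<Prod>r\<in>UNIV. hl_q r (inverse qpar) (c r)) * F)
        (mconst ((- inverse qpar) ^ a) * (\<Prod>r\<in>UNIV. hl_q r qpar (c r)) * G)"
      using omega_pair_prod_hl_q[OF assms(1), of "inverse qpar" UNIV c] by simp
  qed
  also have "mconst s * (\<Sum>c | sum c UNIV = a. ?u c * ((\<Prod>r\<in>UNIV. hl_q r (inverse qpar) (c r)) * F)) =
      shoji_q i a * F"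
    by (simp add: shoji_q_def s_def[symmetric] sum_distrib_right mult.assoc)
  also have "mconst s * (\<Sum>c | sum c UNIV = a. ?u c * (mconst ((- inverse qpar) ^ a) *
        (\<Prod>r\<in>UNIV. hl_q r qpar (c r)) * G)) =
      mconst (s * (- inverse qpar) ^ a) *
        (\<Sum>c | sum c UNIV = a. ?u c * (\<Prod>r\<in>UNIV. hl_q r qpar (c r))) * G"
    by (simp add: mconst_mult sum_distrib_left sum_distrib_right mult_ac)
  also have "\<dots> = mconst ((- qpar) ^ (a - 1)) * mmap at_qinv (shoji_q i a) * G"
    by (simp only: s_def shoji_scalar[OF qpar_neq_0 qpar_neq_1 assms(2)] mconst_mult
        mmap_at_qinv_shoji_q mult.assoc)
  finally show ?thesis .
qed

lemma schur_empty: "schur r (\<lambda>_. 0) = 1"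
proof (rule mfps_eqI)
  fix e
  have "{T. is_ssyt (\<lambda>_. 0) T \<and> ssyt_weight r (\<lambda>_. 0) T = e} = (if e = 0 then {\<lambda>_ _. 0} else {})"
    by (auto simp: is_ssyt_def ssyt_weight_def cells_def fun_eq_iff)
  thus "mcoeff (schur r (\<lambda>_. 0) :: ('a \<times> nat, 'b) mfps) e = mcoeff 1 e"
    by (simp add: schur_def mcoeff_one)
qed

lemma omega_pair_1: "omega_pair 0 1 1"
proof -
  let ?\<mu> = "\<lambda>_ _. 0 :: nat"
  have "?\<mu> \<in> multipartitions_of 0"
    by (simp add: multipartitions_of_def multipartitions_def is_partition_def antimono_def
        mpart_size_def part_size_def)
  from omega_pair_mschur[OF this] show ?thesis
    by (simp add: mpart_conj_def part_conj_def[abs_def] mschur_def schur_empty)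
qed

lemma omega_pair_prod_shoji_q:
  assumes "finite S" "\<And>x. x \<in> S \<Longrightarrow> a x > 0"
  shows "omega_pair (\<Sum>x\<in>S. a x) (\<Prod>x\<in>S. shoji_q (i x) (a x))
    (mconst ((- qpar) ^ ((\<Sum>x\<in>S. a x) - card S)) * mmap at_qinv (\<Prod>x\<in>S. shoji_q (i x) (a x)))"
  using assms
proof (induction S rule: finite_induct)
  case empty
  show ?case
    by (simp add: at_qinv.mmap_1 omega_pair_1)
next
  case (insert x S)
  let ?e = "(\<Sum>x\<in>S. a x) - card S"
  \<comment> \<open>All entries are positive, so the truncated differences in the exponents are
    exact and add up.\<close>
  have "card S = (\<Sum>x\<in>S. 1)"
    by simp
  also have "\<dots> \<le> (\<Sum>x\<in>S. a x)"
    by (rule sum_mono) (use insert.prems in \<open>force simp: Suc_le_eq\<close>)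
  finally have "(\<Sum>x\<in>insert x S. a x) - card (insert x S) = (a x - 1) + ?e"
    using insert.hyps insert.prems[of x] by simp
  moreover have "omega_pair (sum a S + a x) (shoji_q (i x) (a x) * (\<Prod>x\<in>S. shoji_q (i x) (a x)))
      (mconst ((- qpar) ^ (a x - 1)) * mmap at_qinv (shoji_q (i x) (a x)) *
       (mconst ((- qpar) ^ ?e) * mmap at_qinv (\<Prod>x\<in>S. shoji_q (i x) (a x))))"
    by (rule omega_pair_shoji_q) (use insert in auto)
  ultimately show ?case
    using insert.hyps by (simp add: power_add mconst_mult at_qinv.mmap_mult add_ac mult_ac)
qed


section \<open>The theorem\<close>

lemma omega_pair_array:
  assumes "\<alpha> \<in> arrays"
  shows "omega_pair (array_size \<alpha>) (\<Prod>(i, j) | \<alpha> i j > 0. shoji_q i (\<alpha> i j))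
    (mconst ((- qpar) ^ (array_size \<alpha> - array_length \<alpha>)) *
      mmap at_qinv (\<Prod>(i, j) | \<alpha> i j > 0. shoji_q i (\<alpha> i j)))"
  using omega_pair_prod_shoji_q[of "{(i, j). \<alpha> i j > 0}" "\<lambda>(i, j). \<alpha> i j" fst] assms
  by (auto simp: arrays_def array_size_def array_length_def case_prod_unfold)

lemma array_length_le_size:
  assumes "\<alpha> \<in> arrays"
  shows "array_length \<alpha> \<le> array_size \<alpha>"
proof -
  have "array_length \<alpha> = (\<Sum>(i, j) | \<alpha> i j > 0. 1)"
    by (simp add: array_length_def case_prod_unfold)
  also have "\<dots> \<le> array_size \<alpha>"
    unfolding array_size_def by (rule sum_mono) auto
  finally show ?thesis .
qed

lemma chi_conj:
  assumes "lam \<in> multipartitions" "\<alpha> \<in> arrays"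
  shows "chi lam \<alpha> = (- qpar) ^ (array_size \<alpha> - array_length \<alpha>) * at_qinv (chi (mpart_conj lam) \<alpha>)"
proof -
  let ?P = "\<Prod>(i, j) | \<alpha> i j > 0. shoji_q i (\<alpha> i j)"
  note pair = omega_pair_array[OF assms(2)]
  obtain c where c: "?P = (\<Sum>\<mu>\<in>multipartitions_of (array_size \<alpha>). mconst (c \<mu>) * mschur \<mu>)"
    using pair unfolding omega_pair_def by blast
  \<comment> \<open>Substituting in the coefficients exhibits a Schur expansion of the substituted
    product; this allows the scalar to be taken out of its coefficients.\<close>
  have "omega_pair (array_size \<alpha>) (mmap at_qinv ?P)
      (\<Sum>\<mu>\<in>multipartitions_of (array_size \<alpha>). mconst (at_qinv (c \<mu>)) * mschur (mpart_conj \<mu>))"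
    unfolding omega_pair_def
    by (rule exI[of _ "\<lambda>\<mu>. at_qinv (c \<mu>)"])
       (simp add: c at_qinv.mmap_sum at_qinv.mmap_mult at_qinv.mmap_mconst at_qinv.mmap_mschur)
  thus ?thesis
    using omega_pair_coeffs[OF pair assms(1)]
    by (simp add: chi_def schur_coeffs_mconst_mult at_qinv.omega_pair_coeffs_mmap[OF pair])
qed

text \<open>The product attached to \<open>\<alpha>\<close> is homogeneous of degree
  \<open>array_size \<alpha>\<close>. This settles the terms of the generating function indexed by
  arrays of the wrong size.\<close>

lemma chi_eq_0:
  assumes "\<alpha> \<in> arrays" "array_size \<alpha> \<noteq> mpart_size lam"
  shows "chi lam \<alpha> = 0"
  unfolding chi_def by (rule omega_pair_coeffs_degree[OF omega_pair_array[OF assms(1)]]) (use assms in auto)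

lemma multipartition_array:
  assumes "\<mu> \<in> multipartitions"
  shows "\<mu> \<in> arrays" "array_size \<mu> = mpart_size \<mu>" "array_length \<mu> = mpart_length \<mu>"
proof -
  have S: "{(i, j). \<mu> i j > 0} = (SIGMA i:UNIV. {j. \<mu> i j > 0})"
    by auto
  have fin: "finite {j. \<mu> i j > 0}" for i
    using assms by (auto simp: multipartitions_def is_partition_def)
  show "\<mu> \<in> arrays"
    unfolding arrays_def mem_Collect_eq S using fin by auto
  show "array_size \<mu> = mpart_size \<mu>"
    unfolding array_size_def S mpart_size_def part_size_def using fin by (simp add: sum.Sigma)
  show "array_length \<mu> = mpart_length \<mu>"
    unfolding array_length_def S mpart_length_def part_length_def using fin by (simp add: card_SigmaI)
qed

theorem theorem6p14:
  fixes n :: nat and lam :: "'m::{finite,linorder} \<Rightarrow> nat \<Rightarrow> nat"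
  assumes "lam \<in> multipartitions" and "mpart_size lam = n"
  shows
    "mmap at_qinv (gen_fun lam) = mconst ((- qpar) powi (- int n)) * gen_fun (mpart_conj lam) \<and>
     (\<forall>\<alpha>\<in>arrays. array_size \<alpha> = n \<longrightarrow>
        chi lam \<alpha> = (- qpar) powi (int n - int (array_length \<alpha>)) * at_qinv (chi (mpart_conj lam) \<alpha>)) \<and>
     (\<forall>\<mu>\<in>multipartitions. mpart_size \<mu> = n \<longrightarrow>
        chi lam \<mu> = (- qpar) powi (int n - int (mpart_length \<mu>)) * at_qinv (chi (mpart_conj lam) \<mu>))"
proof (intro conjI ballI impI)
  \<comment> \<open>The length is at most the size, so the integer exponent is a natural number and
    \<open>chi_conj\<close> applies.\<close>
  show arr: "chi lam \<alpha> = (- qpar) powi (int n - int (array_length \<alpha>)) * at_qinv (chi (mpart_conj lam) \<alpha>)"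
    if "\<alpha> \<in> arrays" "array_size \<alpha> = n" for \<alpha>
    using chi_conj[OF assms(1) that(1)] array_length_le_size[OF that(1)] that(2)
    by (simp flip: of_nat_diff)
  show "chi lam \<mu> = (- qpar) powi (int n - int (mpart_length \<mu>)) * at_qinv (chi (mpart_conj lam) \<mu>)"
    if "\<mu> \<in> multipartitions" "mpart_size \<mu> = n" for \<mu>
    using arr[of \<mu>] multipartition_array[OF that(1)] that(2) by simp
  have "lam \<in> multipartitions_of n"
    using assms by (simp add: multipartitions_of_def)
  hence lam': "mpart_conj lam \<in> multipartitions" "mpart_size (mpart_conj lam) = n"
    using mpart_conj_in_multipartitions_of by (auto simp: multipartitions_of_def)
  show "mmap at_qinv (gen_fun lam) = mconst ((- qpar) powi (- int n)) * gen_fun (mpart_conj lam)"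
  proof (rule mfps_eqI)
    fix e :: "'m \<times> nat \<Rightarrow>\<^sub>0 nat"
    define \<alpha> where "\<alpha> = (\<lambda>i j. Poly_Mapping.lookup e (i, j))"
    let ?l = "array_length \<alpha>" and ?q = "qpar :: 'm qufield"
    have "{(i, j). \<alpha> i j > 0} = Poly_Mapping.keys e"
      by (auto simp: \<alpha>_def in_keys_iff)
    hence \<alpha>: "\<alpha> \<in> arrays"
      by (simp add: arrays_def)
    have "(inverse ?q - 1) ^ ?l * at_qinv (chi lam \<alpha>) =
        (- ?q) powi (- int n) * ((?q - 1) ^ ?l * chi (mpart_conj lam) \<alpha>)"
    proof (cases "array_size \<alpha> = n")
      case True
      \<comment> \<open>The rule is used at the conjugate of \<open>lam\<close>, so that the
        substitution falls on \<open>chi lam \<alpha>\<close>, as it does in the generating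
        function.\<close>
      have "chi (mpart_conj lam) \<alpha> = (- ?q) ^ (n - ?l) * at_qinv (chi lam \<alpha>)"
        using chi_conj[OF lam'(1) \<alpha>] True by (simp add: mpart_conj_conj assms(1))
      moreover have "(- ?q) ^ n * (inverse ?q - 1) ^ ?l = (?q - 1) ^ ?l * (- ?q) ^ (n - ?l)"
      proof -
        have "(- ?q) ^ n = (- ?q) ^ (n - ?l) * (- ?q) ^ ?l"
          using array_length_le_size[OF \<alpha>] True by (simp add: power_add[symmetric])
        \<comment> \<open>Each factor contributes -q (1/q - 1) = q - 1: the powers of
          \<open>qpar - 1\<close> in the generating function absorb the dependence on the
          length.\<close>
        moreover have "(- ?q) ^ ?l * (inverse ?q - 1) ^ ?l = (?q - 1) ^ ?l"
          by (simp add: power_mult_distrib[symmetric] algebra_simps)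
        ultimately show ?thesis
          by (simp add: mult_ac)
      qed
      hence "(inverse ?q - 1) ^ ?l = (- ?q) powi (- int n) * ((?q - 1) ^ ?l * (- ?q) ^ (n - ?l))"
        by (simp add: power_int_minus field_simps)
      ultimately show ?thesis
        by (simp add: mult.assoc)
    next
      case False
      thus ?thesis
        using chi_eq_0[OF \<alpha>, of lam] chi_eq_0[OF \<alpha>, of "mpart_conj lam"] assms(2) lam'(2)
        by (simp add: at_qinv.zero)
    qed
    thus "mcoeff (mmap at_qinv (gen_fun lam)) e =
        mcoeff (mconst ((- qpar) powi (- int n)) * gen_fun (mpart_conj lam)) e"
      by (simp add: gen_fun_def Let_def \<alpha>_def[symmetric] at_qinv.mult at_qinv_power at_qinv_diff
          at_qinv.one)
  qed
qed

end
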